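(* Let $\Omega^+\subseteq\mathbb{R}^2$ be a Jordan domain, let $\Omega^-:=\mathbb{R}^2\setminus\overline{\Omega^+}$, and let $\Gamma:=\partial\Omega^{\pm}$ be their common boundary. Fix $\alpha\in(0,1)$ and $C_0>0$. Suppose there exists $r_0>0$ such that $$\varepsilon(x,r)\le C_0 r^{\alpha}\qquad\text{for all } x\in\Gamma,\ r\le r_0 .$$ Then $\Gamma$ is a $C^{1,\beta}$-manifold of dimension $1$ in $\mathbb{R}^2$, where $\beta>0$ depends on $\alpha$.
   Context: A Jordan domain is a domain in $\mathbb{R}^2$ whose boundary is a Jordan curve. For $x\in\Gamma$ and $r>0$, $I^{\pm}(x,r)$ denotes the largest (with respect to $\mathcal{H}^1$-measure) open arc of the circumference $\partial B(x,r)$ contained in $\Omega^{\pm}$. The Carleson $\varepsilon$-function is $$\varepsilon(x,r)=\frac1r\max\left\{|\pi r-\mathcal{H}^1(I^+(x,r))|,\ |\pi r-\mathcal{H}^1(I^-(x,r))|\right\}.$$ A $C^{1,\beta}$-manifold of dimension $1$ in $\mathbb{R}^2$ is a set that is, near each of its points and up to rotation, the graph of a $C^1$ function of one variable whose derivative is $\beta$-Hölder continuous. *)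

theory Defs
  imports "HOL-Analysis.Analysis"
begin

text \<open>The Euclidean plane is represented by the type \<^typ>\<open>complex\<close>, as in the library's
  Jordan curve theorem.\<close>

text \<open>One-dimensional Hausdorff measure, normalised so that it agrees with length on segments.
  Boundedness is required because \<^const>\<open>diameter\<close> is meaningless on unbounded sets.\<close>

definition hausdorff1_delta :: "real \<Rightarrow> 'a::metric_space set \<Rightarrow> ennreal" where
  "hausdorff1_delta \<delta> A =
     (INF U \<in> {U :: nat \<Rightarrow> 'a set. A \<subseteq> (\<Union>i. U i) \<and> (\<forall>i. bounded (U i) \<and> diameter (U i) \<le> \<delta>)}.
        \<Sum>i. ennreal (diameter (U i)))"

definition hausdorff1 :: "'a::metric_space set \<Rightarrow> ennreal" where
  "hausdorff1 A = (SUP \<delta> \<in> {0<..}. hausdorff1_delta \<delta> A)"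

definition jordan_domain :: "complex set \<Rightarrow> bool" where
  "jordan_domain \<Omega> \<longleftrightarrow> \<Omega> \<noteq> {} \<and> open \<Omega> \<and> connected \<Omega> \<and>
     (\<exists>c. simple_path c \<and> pathfinish c = pathstart c \<and> path_image c = frontier \<Omega>)"

text \<open>The case \<open>b \<le> a\<close> gives the empty arc, which is the largest one inside a set that
  misses the circle. The case \<open>b = a + 2 * pi\<close> gives the circle without one point, which has
  full measure.\<close>

definition open_arc :: "complex \<Rightarrow> real \<Rightarrow> complex set \<Rightarrow> bool" where
  "open_arc x r I \<longleftrightarrow>
     (\<exists>a b. b \<le> a + 2 * pi \<and> I = (\<lambda>t. x + of_real r * cis t) ` {a<..<b})"

text \<open>If several arcs have the same maximal measure, one of them is chosen arbitrarily; only its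
  measure matters below.\<close>

definition largest_arc :: "complex set \<Rightarrow> complex \<Rightarrow> real \<Rightarrow> complex set" where
  "largest_arc \<Omega> x r = (ARG_MAX hausdorff1 I. open_arc x r I \<and> I \<subseteq> \<Omega>)"

definition carleson_eps :: "complex set \<Rightarrow> complex \<Rightarrow> real \<Rightarrow> real" where
  "carleson_eps \<Omega> x r = 1 / r *
     max \<bar>pi * r - enn2real (hausdorff1 (largest_arc \<Omega> x r))\<bar>
         \<bar>pi * r - enn2real (hausdorff1 (largest_arc (- closure \<Omega>) x r))\<bar>"

definition C1_holder_on :: "real \<Rightarrow> real set \<Rightarrow> (real \<Rightarrow> real) \<Rightarrow> bool" where
  "C1_holder_on \<beta> J f \<longleftrightarrow> f differentiable_on J \<and> continuous_on J (deriv f) \<and>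
     (\<exists>C. \<forall>s\<in>J. \<forall>t\<in>J. \<bar>deriv f s - deriv f t\<bar> \<le> C * \<bar>s - t\<bar> powr \<beta>)"

text \<open>Multiplication by \<^term>\<open>cis \<theta>\<close> is the rotation by the angle \<open>\<theta>\<close>. The parameter interval is
  open, so \<^const>\<open>deriv\<close> is the usual two-sided derivative at each of its points.\<close>

definition C1_holder_curve :: "real \<Rightarrow> complex set \<Rightarrow> bool" where
  "C1_holder_curve \<beta> \<Gamma> \<longleftrightarrow>
     (\<forall>p\<in>\<Gamma>. \<exists>U \<theta> a b f. open U \<and> p \<in> U \<and> C1_holder_on \<beta> {a<..<b} f \<and>
        \<Gamma> \<inter> U = (\<lambda>t. cis \<theta> * Complex t (f t)) ` {a<..<b})"

end

theory Submission
  imports Defs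
begin

text \<open>
  The exponent can be taken to be \<open>\<beta> = \<alpha>\<close>. The smallness of the Carleson function says that each
  small circle about a boundary point is split into an arc inside the domain and an arc inside the
  exterior that are both almost half circles (\<open>carleson_eps_split_circle\<close>). So the circle has a
  normal \<open>n x r\<close>, and the boundary meets the circle only, but certainly, near the two directions
  orthogonal to it. What has to be shown is that \<open>n x r\<close> converges as \<open>r\<close> tends to \<open>0\<close>, with a rate. A
  single center does not give this, since a spiral splits all circles about its own center evenly. Two
  facts that involve several boundary points do.

  First, circles about two boundary points \<open>x\<close> and \<open>y\<close>, the first one through \<open>y\<close>, intersect in two
  points on different sides of the boundary (\<open>two_circles\<close>). If the first radius is almost half
  of the second one, this shows that the normals at \<open>y\<close> for the radii \<open>r\<close> and about \<open>2 * r\<close> nearly agree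
  (\<open>doubling\<close>). For intermediate radii it still shows that the normals enclose an angle well
  below a right angle (\<open>comparable\<close>).

  Second, the boundary is almost invariant under the reflection about each of its points
  (\<open>frontier_reflect\<close>). If the direction in which the boundary is seen from \<open>y\<close> differs by an
  angle between two comparable radii, with boundary points \<open>z\<close> and \<open>w\<close>, then the reflection \<open>2 * w - z\<close>
  is seen from \<open>y\<close> under an angle that is larger by a fixed factor (\<open>sine_step\<close>). By doubling,
  its distance from \<open>y\<close> may be taken in the same range. So the largest angle is bounded by a multiple of
  the defect of the circles (\<open>normal_stable\<close>).

  As the defect decays like \<open>r powr \<alpha>\<close>, the normals converge along dyadic radii with a geometric
  series as error, and the limit is a Hoelder continuous unit normal (\<open>holder_normal_exists\<close>). A
  boundary with such a normal is locally a graph whose affine approximations have an error of order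
  \<open>1 + \<alpha>\<close> (\<open>holder_normal_curve\<close>).
\<close>

section \<open>Circles split by a domain\<close>

lemma frame_norm:
  fixes u w :: complex
  assumes "norm u = 1"
  shows "(w \<bullet> u)\<^sup>2 + (w \<bullet> (\<i> * u))\<^sup>2 = (norm w)\<^sup>2"
proof -
  have "(w \<bullet> u)\<^sup>2 + (w \<bullet> (\<i> * u))\<^sup>2 = (norm w)\<^sup>2 * (norm u)\<^sup>2"
    unfolding cmod_power2 inner_complex_def by (simp add: power2_eq_square algebra_simps)
  with assms show ?thesis by simp
qed

lemma frame_inner:
  fixes u a b :: complex
  assumes "norm u = 1"
  shows "a \<bullet> b = (a \<bullet> u) * (b \<bullet> u) + (a \<bullet> (\<i> * u)) * (b \<bullet> (\<i> * u))"
proof -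
  have "(a \<bullet> u) * (b \<bullet> u) + (a \<bullet> (\<i> * u)) * (b \<bullet> (\<i> * u)) = (a \<bullet> b) * (norm u)\<^sup>2"
    unfolding cmod_power2 inner_complex_def by (simp add: power2_eq_square algebra_simps)
  with assms show ?thesis by simp
qed

lemma inner_ii_self [simp]: "u \<bullet> (\<i> * u) = 0" "(\<i> * u) \<bullet> u = 0"
  by (simp_all add: inner_complex_def)

lemma inner_ii_ii [simp]: "(\<i> * u) \<bullet> (\<i> * w) = u \<bullet> w"
  by (simp add: inner_complex_def)

text \<open>The distance of two unit vectors in the same half plane is at most \<open>sqrt 2\<close> times the sine of
  their angle. The constant \<open>3/2\<close> keeps later estimates rational.\<close>

lemma norm_diff_unit_le:
  fixes a b :: complex
  assumes "norm a = 1" "norm b = 1" "\<bar>a \<bullet> (\<i> * b)\<bar> \<le> d" "0 \<le> a \<bullet> b"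
  shows "norm (a - b) \<le> 3/2 * d"
proof -
  have d: "0 \<le> d" using assms(3) by linarith
  have 1: "(a \<bullet> b)\<^sup>2 + (a \<bullet> (\<i> * b))\<^sup>2 = 1" using frame_norm[OF assms(2), of a] assms(1) by simp
  have le1: "a \<bullet> b \<le> 1" using Cauchy_Schwarz_ineq2[of a b] assms by simp
  have "(norm (a - b))\<^sup>2 = 2 - 2 * (a \<bullet> b)"
    using assms(1,2) dot_norm_neg[of a b] by simp
  also have "\<dots> \<le> 2 * (1 - (a \<bullet> b)\<^sup>2)"
    using mult_left_mono[OF le1 assms(4)] by (simp add: power2_eq_square)
  also have "\<dots> = 2 * \<bar>a \<bullet> (\<i> * b)\<bar>\<^sup>2" using 1 by simp
  also have "\<dots> \<le> 2 * d\<^sup>2" using power_mono[OF assms(3) abs_ge_zero, of 2] by linarith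
  also have "\<dots> \<le> (3/2 * d)\<^sup>2" by (simp add: power2_eq_square)
  finally show ?thesis by (rule power2_le_imp_le) (use d in simp)
qed

text \<open>The normal \<open>n\<close> of a split circle points into the domain: the cap of directions \<open>v\<close> with
  \<open>v \<bullet> n > e\<close> lies in the domain and the opposite cap in its exterior. In terms of inner products there
  are no angles to be taken modulo \<open>2 * pi\<close>.\<close>

definition splits_circle :: "complex set \<Rightarrow> complex \<Rightarrow> real \<Rightarrow> real \<Rightarrow> complex \<Rightarrow> bool" where
  "splits_circle \<Omega> x r e n \<longleftrightarrow> norm n = 1 \<and>
     (\<forall>v. norm v = 1 \<longrightarrow>
        (e < v \<bullet> n \<longrightarrow> x + r *\<^sub>R v \<in> \<Omega>) \<and> (v \<bullet> n < - e \<longrightarrow> x + r *\<^sub>R v \<notin> closure \<Omega>))"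

lemma splits_circle_norm: "splits_circle \<Omega> x r e n \<Longrightarrow> norm n = 1"
  and splits_circle_in: "splits_circle \<Omega> x r e n \<Longrightarrow> norm v = 1 \<Longrightarrow> e < v \<bullet> n \<Longrightarrow> x + r *\<^sub>R v \<in> \<Omega>"
  and splits_circle_out: "splits_circle \<Omega> x r e n \<Longrightarrow> norm v = 1 \<Longrightarrow> v \<bullet> n < - e \<Longrightarrow> x + r *\<^sub>R v \<notin> closure \<Omega>"
  by (auto simp: splits_circle_def)

text \<open>A boundary point on a split circle lies in neither of the two caps, so all that remains for
  it are the two short arcs around the directions orthogonal to \<open>n\<close>.\<close>

lemma splits_circle_near:
  assumes "open \<Omega>" "splits_circle \<Omega> x r e n" "y \<in> frontier \<Omega>" "norm (y - x) = r" "0 < r"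
  shows "\<bar>(y - x) \<bullet> n\<bar> \<le> e * r"
proof -
  define v where "v = (1 / r) *\<^sub>R (y - x)"
  have v: "norm v = 1" "y = x + r *\<^sub>R v" using assms by (auto simp: v_def)
  have "y \<notin> \<Omega>" "y \<in> closure \<Omega>" using assms by (auto simp: frontier_def interior_open)
  then have "\<bar>v \<bullet> n\<bar> \<le> e"
    using splits_circle_in[OF assms(2) v(1)] splits_circle_out[OF assms(2) v(1)] v(2)
    by force
  then show ?thesis using assms(5) v(2) by (simp add: abs_mult mult.commute)
qed

text \<open>Both short arcs do contain a boundary point: the half circle through \<open>u\<close> that joins the poles
  \<open>n\<close> and \<open>- n\<close> is connected and runs from the domain to its exterior.\<close>

lemma splits_circle_point:
  assumes "open \<Omega>" "splits_circle \<Omega> x r e n" "0 < r" "0 \<le> e" "e < 1"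
    and u: "u = \<i> * n \<or> u = - (\<i> * n)"
  obtains y where "y \<in> frontier \<Omega>" "norm (y - x) = r" "norm (y - x - r *\<^sub>R u) \<le> 3/2 * e * r"
proof -
  note n = splits_circle_norm[OF assms(2)]
  have nu: "norm u = 1" using u n by (auto simp: norm_mult)
  have un: "u \<bullet> n = 0" using u by auto
  have nn: "n \<bullet> n = 1" "u \<bullet> u = 1" using n nu by (simp_all add: norm_eq_1)
  define g where "g t = cos t *\<^sub>R u + sin t *\<^sub>R n" for t :: real
  have ng: "norm (g t) = 1" for t
  proof -
    have "g t \<bullet> g t = (cos t)\<^sup>2 + (sin t)\<^sup>2"
      using un nn unfolding g_def
      by (simp add: inner_add inner_commute[of n u] power2_eq_square)
    then show ?thesis by (simp add: norm_eq_1)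
  qed
  have gn: "g t \<bullet> n = sin t" for t using un nn by (simp add: g_def inner_add)
  have gu: "g t \<bullet> u = cos t" for t using un nn by (simp add: g_def inner_add inner_commute[of n u])
  let ?A = "(\<lambda>t. x + r *\<^sub>R g t) ` {-(pi/2)..pi/2}"
  have "connected ?A" unfolding g_def by (intro connected_continuous_image continuous_intros) auto
  moreover have "?A \<inter> \<Omega> \<noteq> {}"
  proof -
    have "x + r *\<^sub>R g (pi/2) \<in> \<Omega>"
      using splits_circle_in[OF assms(2) ng] gn assms(5) by simp
    moreover have "pi/2 \<in> {-(pi/2)..pi/2}" by simp
    ultimately show ?thesis by blast
  qed
  moreover have "?A - \<Omega> \<noteq> {}"
  proof -
    have "x + r *\<^sub>R g (-(pi/2)) \<notin> \<Omega>"
      using splits_circle_out[OF assms(2) ng, of "-(pi/2)"] gn assms(5) closure_subset by auto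
    moreover have "-(pi/2) \<in> {-(pi/2)..pi/2}" by simp
    ultimately show ?thesis by blast
  qed
  ultimately have "?A \<inter> frontier \<Omega> \<noteq> {}"
    by (rule connected_Int_frontier)
  then obtain t where t: "-(pi/2) \<le> t" "t \<le> pi/2" and y: "x + r *\<^sub>R g t \<in> frontier \<Omega>" by auto
  let ?y = "x + r *\<^sub>R g t"
  have ny: "norm (?y - x) = r" using ng assms(3) by simp
  have "\<bar>(?y - x) \<bullet> n\<bar> \<le> e * r" using splits_circle_near[OF assms(1,2) y ny assms(3)] .
  then have "\<bar>g t \<bullet> n\<bar> \<le> e" using assms(3) by (simp add: abs_mult mult.commute)
  moreover have "\<bar>g t \<bullet> (\<i> * u)\<bar> = \<bar>g t \<bullet> n\<bar>"
    using u by (auto simp: mult.assoc[symmetric])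
  ultimately have "norm (g t - u) \<le> 3/2 * e"
    using norm_diff_unit_le[OF ng nu, of t e] gu t cos_ge_zero[of t] by simp
  moreover have "?y - x - r *\<^sub>R u = r *\<^sub>R (g t - u)" by (simp add: algebra_simps)
  ultimately have "norm (?y - x - r *\<^sub>R u) \<le> 3/2 * e * r"
    using assms(3) by simp
  with that y ny show thesis by blast
qed

section \<open>From the Carleson function to split circles\<close>

lemma hausdorff1_mono_nonexpansive:
  fixes f :: "'a::metric_space \<Rightarrow> 'b::metric_space"
  assumes f: "\<And>x y. dist (f x) (f y) \<le> dist x y" and A: "A \<subseteq> f ` B"
  shows "hausdorff1 A \<le> hausdorff1 B"
proof -
  have diam: "bounded (f ` U) \<and> diameter (f ` U) \<le> diameter U" if U: "bounded U" for U
  proof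
    obtain c d where "\<forall>y\<in>U. dist c y \<le> d" using U by (auto simp: bounded_def)
    then show "bounded (f ` U)"
      unfolding bounded_def using f order_trans by (intro exI[of _ "f c"] exI[of _ d]) blast
    show "diameter (f ` U) \<le> diameter U"
    proof (cases "U = {}")
      case False
      then show ?thesis
        unfolding diameter_def[of "f ` U"]
        by (auto intro!: cSUP_least order_trans[OF f] diameter_bounded_bound[OF U])
    qed simp
  qed
  have "hausdorff1_delta \<delta> A \<le> hausdorff1_delta \<delta> B" for \<delta>
    unfolding hausdorff1_delta_def
  proof (rule INF_greatest)
    fix U :: "nat \<Rightarrow> 'a set" assume U: "U \<in> {U. B \<subseteq> (\<Union>i. U i) \<and> (\<forall>i. bounded (U i) \<and> diameter (U i) \<le> \<delta>)}"
    show "(INF U \<in> {U :: nat \<Rightarrow> 'b set. A \<subseteq> (\<Union>i. U i) \<and> (\<forall>i. bounded (U i) \<and> diameter (U i) \<le> \<delta>)}.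
        \<Sum>i. ennreal (diameter (U i))) \<le> (\<Sum>i. ennreal (diameter (U i)))"
    proof (rule INF_lower2)
      have "B \<subseteq> (\<Union>i. U i)" using U by simp
      then have "f ` B \<subseteq> (\<Union>i. f ` U i)" unfolding image_UN[symmetric] by (rule image_mono)
      with A have "A \<subseteq> (\<Union>i. f ` U i)" by (rule subset_trans)
      moreover have "\<forall>i. bounded (f ` U i) \<and> diameter (f ` U i) \<le> \<delta>"
      proof
        fix i
        have "bounded (U i)" "diameter (U i) \<le> \<delta>" using U by auto
        with diam[of "U i"] show "bounded (f ` U i) \<and> diameter (f ` U i) \<le> \<delta>" by linarith
      qed
      ultimately show "(\<lambda>i. f ` U i) \<in> {U. A \<subseteq> (\<Union>i. U i) \<and> (\<forall>i. bounded (U i) \<and> diameter (U i) \<le> \<delta>)}"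
        by (intro CollectI conjI)
      show "(\<Sum>i. ennreal (diameter (f ` U i))) \<le> (\<Sum>i. ennreal (diameter (U i)))"
        using diam U by (intro suminf_le ennreal_leI) auto
    qed
  qed
  then show ?thesis unfolding hausdorff1_def by (intro SUP_mono) blast
qed

text \<open>Cutting the interval into equal pieces not longer than \<open>\<delta>\<close> gives a cover whose diameters add up
  to its length.\<close>

lemma hausdorff1_interval_le:
  fixes a b :: real
  assumes "a \<le> b"
  shows "hausdorff1 {a<..<b} \<le> ennreal (b - a)"
  unfolding hausdorff1_def
proof (rule SUP_least)
  fix \<delta> :: real assume "\<delta> \<in> {0<..}"
  then have \<delta>: "0 < \<delta>" by simp
  obtain N :: nat where N: "(b - a) / \<delta> < real N" using reals_Archimedean2 by blast
  have "0 \<le> (b - a) / \<delta>" using assms \<delta> by simp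
  with N have N0: "0 < real N" by linarith
  define h where "h = (b - a) / real N"
  have h: "0 \<le> h" "h \<le> \<delta>" "real N * h = b - a"
    using assms N N0 \<delta> by (auto simp: h_def field_simps)
  define U where "U i = (if i < N then {a + real i * h .. a + (real i + 1) * h} else {})" for i
  have "{a<..<b} \<subseteq> (\<Union>i. U i)"
  proof
    fix t assume t: "t \<in> {a<..<b}"
    with h N0 have h0: "0 < h" by (auto simp: h_def)
    define i where "i = nat \<lfloor>(t - a) / h\<rfloor>"
    have "0 \<le> (t - a) / h" using t h0 by simp
    then have i: "real i \<le> (t - a) / h" "(t - a) / h < real i + 1"
      unfolding i_def by linarith+
    then have i': "real i * h \<le> t - a" "t - a < (real i + 1) * h"
      using h0 by (simp_all add: field_simps)
    have "real i * h < real N * h" using i' t h by simp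
    then have "i < N" using h0 by simp
    with i' show "t \<in> (\<Union>i. U i)" by (auto simp: U_def intro!: exI[of _ i])
  qed
  moreover have dU: "diameter (U i) = (if i < N then h else 0)" for i
    using h by (simp add: U_def algebra_simps)
  moreover have "bounded (U i)" for i by (simp add: U_def)
  ultimately have "U \<in> {U. {a<..<b} \<subseteq> (\<Union>i. U i) \<and> (\<forall>i. bounded (U i) \<and> diameter (U i) \<le> \<delta>)}"
    using h \<delta> by auto
  then have "hausdorff1_delta \<delta> {a<..<b} \<le> (\<Sum>i. ennreal (diameter (U i)))"
    unfolding hausdorff1_delta_def by (rule INF_lower)
  also have "\<dots> = (\<Sum>i<N. ennreal (diameter (U i)))"
    by (rule suminf_finite) (auto simp: dU)
  also have "\<dots> = (\<Sum>i<N. ennreal h)" by (rule sum.cong) (auto simp: dU)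
  also have "\<dots> = ennreal (\<Sum>i<N. h)" using h by (intro sum_ennreal) auto
  finally show "hausdorff1_delta \<delta> {a<..<b} \<le> ennreal (b - a)" using h by simp
qed

definition circle_point :: "complex \<Rightarrow> real \<Rightarrow> real \<Rightarrow> complex" where
  "circle_point x r t = x + of_real r * cis t"

lemma dist_cis_le: "dist (cis s) (cis t) \<le> \<bar>s - t\<bar>"
proof -
  have "(dist (cis s) (cis t))\<^sup>2 = (cos s - cos t)\<^sup>2 + (sin s - sin t)\<^sup>2"
    by (simp add: dist_norm cmod_power2)
  also have "\<dots> = 2 - 2 * cos (s - t)"
    using sin_cos_squared_add[of s] sin_cos_squared_add[of t]
    by (simp add: cos_diff power2_eq_square algebra_simps)
  also have "\<dots> = 4 * (sin ((s - t) / 2))\<^sup>2"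
  proof -
    have "cos (2 * ((s - t) / 2)) = 1 - 2 * (sin ((s - t) / 2))\<^sup>2" by (rule cos_double_sin)
    moreover have "2 * ((s - t) / 2) = s - t" by simp
    ultimately have "cos (s - t) = 1 - 2 * (sin ((s - t) / 2))\<^sup>2" by metis
    then show ?thesis by linarith
  qed
  also have "\<dots> \<le> 4 * ((s - t) / 2)\<^sup>2"
    using abs_sin_x_le_abs_x[of "(s - t) / 2"] by (simp add: abs_le_square_iff[symmetric] del: abs_divide)
  also have "\<dots> = \<bar>s - t\<bar>\<^sup>2" by (simp add: power2_eq_square)
  finally show ?thesis by (rule power2_le_imp_le) simp
qed

text \<open>The parametrization by arc length is nonexpansive. Read backwards, this estimate turns a lower
  bound on the measure of an arc into one on its angle.\<close>

lemma hausdorff1_arc_le: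
  assumes "0 < r" "a \<le> b"
  shows "hausdorff1 (circle_point x r ` {a<..<b}) \<le> ennreal (r * (b - a))"
proof -
  define g where "g s = circle_point x r (s / r)" for s
  have "dist (g s) (g t) \<le> dist s t" for s t
  proof -
    have "dist (g s) (g t) = r * dist (cis (s / r)) (cis (t / r))"
      using assms by (simp add: g_def circle_point_def dist_norm right_diff_distrib[symmetric] norm_mult)
    also have "\<dots> \<le> r * \<bar>s / r - t / r\<bar>" using assms dist_cis_le by (intro mult_left_mono) auto
    also have "\<dots> = dist s t"
      using assms by (simp add: dist_real_def diff_divide_distrib[symmetric])
    finally show ?thesis .
  qed
  moreover have "circle_point x r ` {a<..<b} \<subseteq> g ` {r * a<..<r * b}"
  proof
    fix z assume "z \<in> circle_point x r ` {a<..<b}"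
    then obtain t where "a < t" "t < b" "z = circle_point x r t" by auto
    with assms show "z \<in> g ` {r * a<..<r * b}" by (intro image_eqI[of _ _ "r * t"]) (auto simp: g_def)
  qed
  ultimately have "hausdorff1 (circle_point x r ` {a<..<b}) \<le> hausdorff1 {r * a<..<r * b}"
    by (rule hausdorff1_mono_nonexpansive)
  also have "\<dots> \<le> ennreal (r * b - r * a)" using assms by (intro hausdorff1_interval_le) auto
  finally show ?thesis by (simp add: right_diff_distrib)
qed

text \<open>A shorter arc is a rotation of a part of a longer one.\<close>

lemma hausdorff1_arc_mono:
  assumes "b' - a' \<le> b - a"
  shows "hausdorff1 (circle_point x r ` {a'<..<b'}) \<le> hausdorff1 (circle_point x r ` {a<..<b})"
proof (rule hausdorff1_mono_nonexpansive)
  let ?f = "\<lambda>z. x + (z - x) * cis (a' - a)"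
  show "dist (?f z) (?f w) \<le> dist z w" for z w
    by (simp add: dist_norm left_diff_distrib[symmetric] norm_mult)
  show "circle_point x r ` {a'<..<b'} \<subseteq> ?f ` circle_point x r ` {a<..<b}"
  proof
    fix z assume "z \<in> circle_point x r ` {a'<..<b'}"
    then obtain t where t: "a' < t" "t < b'" "z = circle_point x r t" by auto
    have "z = ?f (circle_point x r (t - a' + a))"
      by (simp add: t circle_point_def mult.assoc cis_mult)
    moreover have "t - a' + a \<in> {a<..<b}" using t assms by auto
    ultimately show "z \<in> ?f ` circle_point x r ` {a<..<b}" by blast
  qed
qed

lemma open_arc_iff:
  "open_arc x r I \<longleftrightarrow> (\<exists>a b. b \<le> a + 2 * pi \<and> I = circle_point x r ` {a<..<b})"
  by (simp add: open_arc_def circle_point_def)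

text \<open>The pairs of end points of arcs inside \<open>S\<close> form a closed set, since a point
  in the interior of a limit arc lies in almost all approximating arcs. After normalising the left
  end to \<open>[0, 2 * pi]\<close> this set is compact and the angle attains its maximum.\<close>

lemma longest_arc_exists:
  "\<exists>a b. b \<le> a + 2 * pi \<and> circle_point x r ` {a<..<b} \<subseteq> S \<and>
    (\<forall>a' b'. b' \<le> a' + 2 * pi \<and> circle_point x r ` {a'<..<b'} \<subseteq> S \<longrightarrow> b' - a' \<le> b - a)"
proof -
  define K where "K = {p :: real \<times> real. fst p \<le> snd p \<and> snd p \<le> fst p + 2 * pi} \<inter>
    (\<Inter>t\<in>{t. circle_point x r t \<notin> S}. {p. t \<le> fst p \<or> snd p \<le> t}) \<inter> ({0..2 * pi} \<times> {0..4 * pi})"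
  have "closed {p :: real \<times> real. fst p \<le> snd p \<and> snd p \<le> fst p + 2 * pi}"
    by (intro closed_Collect_conj closed_Collect_le continuous_intros)
  moreover have "closed (\<Inter>t\<in>{t. circle_point x r t \<notin> S}. {p :: real \<times> real. t \<le> fst p \<or> snd p \<le> t})"
    by (intro closed_INT ballI closed_Collect_disj closed_Collect_le continuous_intros)
  ultimately have "compact K"
    unfolding K_def by (intro closed_Int_compact closed_Int compact_Times) auto
  moreover have "(0, 0) \<in> K" by (auto simp: K_def)
  moreover have "continuous_on K (\<lambda>p. snd p - fst p)" by (intro continuous_intros)
  ultimately obtain p where p: "p \<in> K" "\<And>q. q \<in> K \<Longrightarrow> snd q - fst q \<le> snd p - fst p"
    using continuous_attains_sup[of K "\<lambda>p. snd p - fst p"] by blast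
  show ?thesis
  proof (rule exI[of _ "fst p"], rule exI[of _ "snd p"], intro conjI allI impI)
    have pp: "fst p \<le> snd p" using p(1) by (auto simp: K_def)
    show "snd p \<le> fst p + 2 * pi" using p(1) by (auto simp: K_def)
    then show "circle_point x r ` {fst p<..<snd p} \<subseteq> S" using p(1) by (force simp: K_def)
    fix a' b' assume ab: "b' \<le> a' + 2 * pi \<and> circle_point x r ` {a'<..<b'} \<subseteq> S"
    show "b' - a' \<le> snd p - fst p"
    proof (cases "a' \<le> b'")
      case True
      define k where "k = \<lfloor>a' / (2 * pi)\<rfloor>"
      define c where "c = 2 * pi * of_int k"
      have "of_int k \<le> a' / (2 * pi)" "a' / (2 * pi) < of_int k + 1" unfolding k_def by linarith+
      then have c: "c \<le> a'" "a' \<le> c + 2 * pi" by (auto simp: c_def field_simps)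
      have per: "circle_point x r (t + c) = circle_point x r t" for t
        by (simp add: circle_point_def c_def cis_mult[symmetric] cis_multiple_2pi)
      have "(a' - c, b' - c) \<in> K"
        unfolding K_def
      proof (intro IntI INT_I)
        fix t assume "t \<in> {t. circle_point x r t \<notin> S}"
        then have "circle_point x r (t + c) \<notin> S" using per by simp
        then have "t + c \<notin> {a'<..<b'}" using ab by blast
        then show "(a' - c, b' - c) \<in> {p. t \<le> fst p \<or> snd p \<le> t}" by auto
      qed (use True c ab in auto)
      from p(2)[OF this] show ?thesis by simp
    next
      case False
      then show ?thesis using pp by simp
    qed
  qed
qed

text \<open>Since the measure of an arc is a monotone function of its angle, the arc of maximal angle
  shows that \<^const>\<open>largest_arc\<close> selects from a nonempty set of maximizers, hence is an arc
  inside \<open>S\<close>.\<close>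

lemma largest_arc_angle:
  assumes r: "0 < r" and eps: "\<bar>pi * r - enn2real (hausdorff1 (largest_arc S x r))\<bar> \<le> \<epsilon> * r" "\<epsilon> < pi"
  obtains a b where "pi - \<epsilon> \<le> b - a" "circle_point x r ` {a<..<b} \<subseteq> S"
proof -
  let ?P = "\<lambda>I. open_arc x r I \<and> I \<subseteq> S"
  obtain a0 b0 where 0: "b0 \<le> a0 + 2 * pi" "circle_point x r ` {a0<..<b0} \<subseteq> S"
    "\<forall>a' b'. b' \<le> a' + 2 * pi \<and> circle_point x r ` {a'<..<b'} \<subseteq> S \<longrightarrow> b' - a' \<le> b0 - a0"
    using longest_arc_exists[of x r S] by (elim exE conjE)
  have "is_arg_max hausdorff1 ?P (circle_point x r ` {a0<..<b0})"
    unfolding is_arg_max_linorder open_arc_iff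
  proof (intro conjI allI impI)
    fix J assume "(\<exists>a b. b \<le> a + 2 * pi \<and> J = circle_point x r ` {a<..<b}) \<and> J \<subseteq> S"
    then obtain a' b' where J: "b' \<le> a' + 2 * pi" "J = circle_point x r ` {a'<..<b'}" "J \<subseteq> S"
      by (elim conjE exE)
    then have "b' - a' \<le> b0 - a0" using 0(3) by simp
    then show "hausdorff1 J \<le> hausdorff1 (circle_point x r ` {a0<..<b0})"
      unfolding J(2) by (rule hausdorff1_arc_mono)
  qed (use 0 in auto)
  then have "?P (largest_arc S x r)"
    unfolding largest_arc_def arg_max_def by (rule someI2) (simp add: is_arg_max_def)
  then obtain a b where ab: "largest_arc S x r = circle_point x r ` {a<..<b}"
    "circle_point x r ` {a<..<b} \<subseteq> S"
    by (auto simp: open_arc_iff)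
  have lo: "pi * r - \<epsilon> * r \<le> enn2real (hausdorff1 (circle_point x r ` {a<..<b}))"
    using eps(1) unfolding ab(1) by linarith
  have "pi - \<epsilon> \<le> b - a"
  proof (cases "a \<le> b")
    case True
    have "enn2real (hausdorff1 (circle_point x r ` {a<..<b})) \<le> r * (b - a)"
      using hausdorff1_arc_le[OF r True] True r by (intro enn2real_leI) auto
    with lo have "r * (pi - \<epsilon>) \<le> r * (b - a)" by (simp add: algebra_simps)
    then show ?thesis using r by simp
  next
    case False
    have "hausdorff1 ({} :: complex set) \<le> ennreal (r * 0)"
      using hausdorff1_arc_le[OF r, of 0 0] by simp
    with False lo have "r * (pi - \<epsilon>) \<le> 0" by (simp add: algebra_simps)
    then show ?thesis using r eps by (simp add: mult_le_0_iff)
  qed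
  with that ab show thesis by blast
qed

text \<open>An arc of angle at least \<open>pi - \<epsilon>\<close> contains all directions whose angle to its midpoint is below
  \<open>pi / 2 - \<epsilon> / 2\<close>, and \<open>cos (pi / 2 - \<epsilon> / 2) = sin (\<epsilon> / 2) \<le> \<epsilon> / 2\<close>.\<close>

lemma arc_contains_cap:
  assumes "pi - \<epsilon> \<le> b - a" "0 \<le> \<epsilon>" "norm v = 1" "\<epsilon> / 2 < v \<bullet> cis ((a + b) / 2)"
  shows "x + r *\<^sub>R v \<in> circle_point x r ` {a<..<b}"
proof -
  define m where "m = (a + b) / 2"
  define \<tau> where "\<tau> = Arg (v * cis (- m))"
  have "v \<noteq> 0" using assms(3) by auto
  then have "v * cis (- m) = cis \<tau>"
    using assms(3) cis_Arg[of "v * cis (- m)"] by (simp add: \<tau>_def sgn_div_norm norm_mult)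
  then have "v * (cis (- m) * cis m) = cis \<tau> * cis m" by (simp add: mult.assoc[symmetric])
  then have v: "v = cis (m + \<tau>)" by (simp add: cis_mult add.commute)
  have \<tau>pi: "\<bar>\<tau>\<bar> \<le> pi" using Arg_bounded[of "v * cis (- m)"] by (auto simp: \<tau>_def)
  have "v \<bullet> cis m = cos ((m + \<tau>) - m)"
    unfolding v cos_diff by (simp add: inner_complex_def)
  then have c: "\<epsilon> / 2 < cos \<bar>\<tau>\<bar>" using assms(4) by (simp add: m_def)
  have "\<bar>\<tau>\<bar> < pi / 2 - \<epsilon> / 2"
  proof (rule ccontr)
    assume far: "\<not> \<bar>\<tau>\<bar> < pi / 2 - \<epsilon> / 2"
    have "\<epsilon> / 2 < 1" using c cos_le_one[of "\<bar>\<tau>\<bar>"] by linarith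
    then have "cos \<bar>\<tau>\<bar> \<le> cos (pi / 2 - \<epsilon> / 2)"
      using far \<tau>pi assms(2) pi_gt3 by (intro cos_monotone_0_pi_le) auto
    also have "\<dots> = sin (\<epsilon> / 2)" by (simp add: cos_diff)
    also have "\<dots> \<le> \<epsilon> / 2" using assms(2) by (intro sin_x_le_x) auto
    finally show False using c by simp
  qed
  then have "m + \<tau> \<in> {a<..<b}" using assms(1) by (auto simp: m_def field_simps)
  then show ?thesis
    by (intro image_eqI[of _ _ "m + \<tau>"]) (auto simp: circle_point_def v scaleR_conv_of_real)
qed

text \<open>Two almost half circular arcs that are disjoint must have almost opposite midpoints \<open>n\<close> and \<open>m\<close>:
  otherwise the bisector of \<open>n\<close> and \<open>m\<close> would point into both.\<close>

lemma arcs_split_circle: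
  assumes \<epsilon>: "0 \<le> \<epsilon>"
    and "pi - \<epsilon> \<le> b - a" "circle_point x r ` {a<..<b} \<subseteq> \<Omega>"
    and "pi - \<epsilon> \<le> d - c" "circle_point x r ` {c<..<d} \<subseteq> - closure \<Omega>"
  shows "splits_circle \<Omega> x r (2 * \<epsilon>) (cis ((a + b) / 2))"
proof -
  define n m where "n = cis ((a + b) / 2)" and "m = cis ((c + d) / 2)"
  have unit: "norm n = 1" "norm m = 1" by (simp_all add: n_def m_def)
  then have nn: "n \<bullet> n = 1" "m \<bullet> m = 1" by (simp_all add: norm_eq_1)
  have up: "x + r *\<^sub>R v \<in> \<Omega>" if "norm v = 1" "\<epsilon> / 2 < v \<bullet> n" for v
    using arc_contains_cap[of \<epsilon> b a v x r] assms that by (auto simp: n_def)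
  have down: "x + r *\<^sub>R v \<in> - closure \<Omega>" if "norm v = 1" "\<epsilon> / 2 < v \<bullet> m" for v
    using arc_contains_cap[of \<epsilon> d c v x r] assms that by (auto simp: m_def)
  have opp: "norm (n + m) \<le> \<epsilon>"
  proof (rule ccontr)
    assume *: "\<not> norm (n + m) \<le> \<epsilon>"
    define v where "v = (1 / norm (n + m)) *\<^sub>R (n + m)"
    have s: "0 < norm (n + m)" using * \<epsilon> by linarith
    have v: "norm v = 1" using s by (auto simp: v_def)
    have sq: "(norm (n + m))\<^sup>2 = 2 * ((n + m) \<bullet> n)" "(norm (n + m))\<^sup>2 = 2 * ((n + m) \<bullet> m)"
      using nn by (simp_all add: power2_norm_eq_inner inner_add inner_commute[of m n])
    have "(n + m) \<bullet> n = norm (n + m) * (norm (n + m) / 2)" "(n + m) \<bullet> m = norm (n + m) * (norm (n + m) / 2)"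
      using sq by (simp_all add: power2_eq_square)
    then have "v \<bullet> n = norm (n + m) / 2" "v \<bullet> m = norm (n + m) / 2"
      using s unfolding v_def inner_scaleR_left by simp_all
    with * up[OF v] down[OF v] closure_subset show False by auto
  qed
  have "splits_circle \<Omega> x r (2 * \<epsilon>) n"
    unfolding splits_circle_def
  proof (intro conjI allI impI)
    fix v :: complex assume v: "norm v = 1"
    show "x + r *\<^sub>R v \<in> \<Omega>" if "2 * \<epsilon> < v \<bullet> n" using up[OF v] that \<epsilon> by simp
    show "x + r *\<^sub>R v \<notin> closure \<Omega>" if "v \<bullet> n < - (2 * \<epsilon>)"
    proof -
      have "\<bar>v \<bullet> (n + m)\<bar> \<le> \<epsilon>" using Cauchy_Schwarz_ineq2[of v "n + m"] v opp by simp
      then have "\<epsilon> / 2 < v \<bullet> m" using that \<epsilon> by (simp add: inner_add_right)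
      from down[OF v this] show ?thesis by simp
    qed
  qed (rule unit)
  then show ?thesis by (simp add: n_def)
qed

lemma carleson_eps_split_circle:
  assumes r: "0 < r" and eps: "carleson_eps \<Omega> x r \<le> \<epsilon>" "\<epsilon> < pi"
  shows "\<exists>n. splits_circle \<Omega> x r (2 * \<epsilon>) n"
proof -
  define A B where "A = \<bar>pi * r - enn2real (hausdorff1 (largest_arc \<Omega> x r))\<bar>"
    and "B = \<bar>pi * r - enn2real (hausdorff1 (largest_arc (- closure \<Omega>) x r))\<bar>"
  have "max A B \<le> \<epsilon> * r"
    using eps(1) r by (simp add: carleson_eps_def A_def B_def field_simps)
  then have AB: "A \<le> \<epsilon> * r" "B \<le> \<epsilon> * r" by auto
  have "0 \<le> \<epsilon> * r" using AB(1) by (simp add: A_def)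
  then have "0 \<le> \<epsilon>" using r by (simp add: zero_le_mult_iff)
  moreover obtain a b where "pi - \<epsilon> \<le> b - a" "circle_point x r ` {a<..<b} \<subseteq> \<Omega>"
    by (rule largest_arc_angle[OF r AB(1)[unfolded A_def] eps(2)])
  moreover obtain c d where "pi - \<epsilon> \<le> d - c" "circle_point x r ` {c<..<d} \<subseteq> - closure \<Omega>"
    by (rule largest_arc_angle[OF r AB(2)[unfolded B_def] eps(2)])
  ultimately show ?thesis by (intro exI) (rule arcs_split_circle)
qed

section \<open>Stability of the normals at comparable radii\<close>

text \<open>On a bounded range of radii it suffices to work with one constant threshold \<open>e\<close>. The family \<open>n x r\<close>
  is any choice of normals, without a relation between different centers or radii; relations of this
  kind are what is derived. The bound on \<open>e\<close> is small enough to absorb all error terms into the numerical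
  constants below.\<close>

locale uniformly_split =
  fixes \<Omega> :: "complex set" and n :: "complex \<Rightarrow> real \<Rightarrow> complex" and e R :: real
  assumes open_domain: "open \<Omega>"
    and e_pos: "0 < e" and e_small: "e \<le> 1/10000"
    and split: "\<And>x r. x \<in> frontier \<Omega> \<Longrightarrow> 0 < r \<Longrightarrow> r \<le> R \<Longrightarrow> splits_circle \<Omega> x r e (n x r)"
begin

lemma norm_normal: "x \<in> frontier \<Omega> \<Longrightarrow> 0 < r \<Longrightarrow> r \<le> R \<Longrightarrow> norm (n x r) = 1"
  using split splits_circle_norm by blast

lemma frontier_near:
  "x \<in> frontier \<Omega> \<Longrightarrow> y \<in> frontier \<Omega> \<Longrightarrow> norm (y - x) = r \<Longrightarrow> 0 < r \<Longrightarrow> r \<le> R \<Longrightarrow>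
    \<bar>(y - x) \<bullet> n x r\<bar> \<le> e * r"
  using splits_circle_near[OF open_domain split] by blast

lemma frontier_point:
  assumes "x \<in> frontier \<Omega>" "0 < r" "r \<le> R" "u = \<i> * n x r \<or> u = - (\<i> * n x r)"
  obtains y where "y \<in> frontier \<Omega>" "norm (y - x) = r" "norm (y - x - r *\<^sub>R u) \<le> 3/2 * e * r"
  using splits_circle_point[OF open_domain split[OF assms(1-3)] assms(2) _ _ assms(4)] e_pos e_small
  by (metis less_eq_real_def order_le_less_trans divide_less_eq_1_pos one_less_numeral_iff
      semiring_norm(76) zero_less_numeral)

text \<open>The boundary is almost symmetric about each of its points: on the circle about \<open>y\<close> through \<open>x\<close>, the
  opposite short arc contains a boundary point, too.\<close>

lemma frontier_reflect:
  assumes "x \<in> frontier \<Omega>" "y \<in> frontier \<Omega>" "norm (x - y) \<le> R"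
  obtains v where "v \<in> frontier \<Omega>" "norm (v - (2 * y - x)) \<le> 3 * e * norm (x - y)"
proof (cases "x = y")
  case True
  with that[of y] assms show thesis by simp
next
  case False
  define d where "d = norm (x - y)"
  have d: "0 < d" "d \<le> R" using False assms by (auto simp: d_def)
  define m where "m = n y d"
  have m: "norm m = 1" using norm_normal[OF assms(2) d] by (simp add: m_def)
  define w where "w = (1 / d) *\<^sub>R (x - y)"
  have w: "norm w = 1" "x - y = d *\<^sub>R w" using d by (auto simp: w_def d_def)
  have "\<bar>(x - y) \<bullet> m\<bar> \<le> e * d"
    using frontier_near[OF assms(2,1) _ d] by (simp add: m_def d_def)
  then have wm: "\<bar>w \<bullet> m\<bar> \<le> e" using d by (simp add: w(2) abs_mult mult.commute)
  define u where "u = (if 0 \<le> w \<bullet> (\<i> * m) then \<i> * m else - (\<i> * m))"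
  have u: "u = \<i> * m \<or> u = - (\<i> * m)" and wu: "0 \<le> w \<bullet> u" by (auto simp: u_def)
  have "norm u = 1" using u m by (auto simp: norm_mult)
  moreover have "\<bar>w \<bullet> (\<i> * u)\<bar> \<le> e" using u wm by (auto simp: mult.assoc[symmetric])
  ultimately have wu: "norm (w - u) \<le> 3/2 * e" using norm_diff_unit_le w wu by blast
  from u have "- u = \<i> * n y d \<or> - u = - (\<i> * n y d)" by (auto simp: m_def)
  from frontier_point[OF assms(2) d this] obtain v where v: "v \<in> frontier \<Omega>"
    "norm (v - y - d *\<^sub>R (- u)) \<le> 3/2 * e * d" by blast
  have eq: "v - (2 * y - x) = (v - y - d *\<^sub>R (- u)) + d *\<^sub>R (w - u)"
    using w(2) by (simp add: algebra_simps)
  have "norm (v - (2 * y - x)) \<le> norm (v - y - d *\<^sub>R (- u)) + norm (d *\<^sub>R (w - u))"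
    unfolding eq by (rule norm_triangle_ineq)
  also have "\<dots> \<le> 3/2 * e * d + d * (3/2 * e)"
    using v wu d by (intro add_mono) auto
  finally show thesis using that[OF v(1)] by (simp add: d_def)
qed

text \<open>This is how different radii are related. The circle about \<open>y\<close> of radius \<open>s\<close> meets the circle about
  \<open>x\<close> of radius \<open>r = norm (y - x)\<close> in the two points \<open>x + r *\<^sub>R (a *\<^sub>R u \<plusminus> b *\<^sub>R \<nu>)\<close>, where
  \<open>s = r * sqrt (2 - 2 * a)\<close>. As soon as \<open>b \<ge> 3 * e\<close>, one of them lies in the domain and
  the other one in the exterior, so they cannot lie in the wrong cap of the circle about \<open>y\<close>. The two
  resulting inequalities for \<open>n y s\<close> combine to the stated one.\<close>

lemma two_circles:
  assumes x: "x \<in> frontier \<Omega>" and y: "y \<in> frontier \<Omega>" and r: "norm (y - x) = r" "0 < r" "r \<le> R"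
  obtains u \<nu> where "norm u = 1" "y - x = r *\<^sub>R u" "\<nu> = \<i> * u \<or> \<nu> = - (\<i> * u)"
    "norm (n x r - \<nu>) \<le> 3/2 * e"
    "\<And>a b. a\<^sup>2 + b\<^sup>2 = 1 \<Longrightarrow> 3 * e \<le> b \<Longrightarrow> r * sqrt (2 - 2 * a) \<le> R \<Longrightarrow>
       (1 - a) * \<bar>n y (r * sqrt (2 - 2 * a)) \<bullet> u\<bar> - e * sqrt (2 - 2 * a)
         \<le> b * (n y (r * sqrt (2 - 2 * a)) \<bullet> \<nu>)"
proof -
  define u where "u = (1 / r) *\<^sub>R (y - x)"
  have u: "norm u = 1" "y - x = r *\<^sub>R u" using r by (auto simp: u_def)
  define m where "m = n x r"
  have m: "norm m = 1" using norm_normal[OF x r(2,3)] by (simp add: m_def)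
  have "\<bar>(y - x) \<bullet> m\<bar> \<le> e * r" using frontier_near[OF x y r] by (simp add: m_def)
  then have um: "\<bar>u \<bullet> m\<bar> \<le> e" using r by (simp add: u(2) abs_mult mult.commute)
  define \<nu> where "\<nu> = (if 0 \<le> m \<bullet> (\<i> * u) then \<i> * u else - (\<i> * u))"
  have \<nu>: "\<nu> = \<i> * u \<or> \<nu> = - (\<i> * u)" and m\<nu>: "0 \<le> m \<bullet> \<nu>" by (auto simp: \<nu>_def)
  have n\<nu>: "norm \<nu> = 1" using \<nu> u by (auto simp: norm_mult)
  have "\<bar>m \<bullet> (\<i> * \<nu>)\<bar> \<le> e" using \<nu> um by (auto simp: mult.assoc[symmetric] inner_commute)
  then have 1: "norm (n x r - \<nu>) \<le> 3/2 * e" using norm_diff_unit_le[OF m n\<nu> _ m\<nu>] by (simp add: m_def)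
  have u\<nu>: "u \<bullet> \<nu> = 0" using \<nu> by auto
  have uu: "u \<bullet> u = 1" "\<nu> \<bullet> \<nu> = 1" using u n\<nu> by (simp_all add: norm_eq_1)
  have "(m \<bullet> u)\<^sup>2 + (m \<bullet> \<nu>)\<^sup>2 = 1" using frame_norm[OF u(1), of m] \<nu> m by auto
  moreover have "(m \<bullet> u)\<^sup>2 \<le> (1/10)\<^sup>2"
    using um e_small by (intro power2_le_iff_abs_le[THEN iffD2]) (auto simp: inner_commute)
  ultimately have "(9/10)\<^sup>2 \<le> (m \<bullet> \<nu>)\<^sup>2" by (simp add: power2_eq_square)
  then have m\<nu>9: "9/10 \<le> m \<bullet> \<nu>" using m\<nu> by (rule power2_le_imp_le)
  have 2: "(1 - a) * \<bar>n y (r * sqrt (2 - 2 * a)) \<bullet> u\<bar> - e * sqrt (2 - 2 * a)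
         \<le> b * (n y (r * sqrt (2 - 2 * a)) \<bullet> \<nu>)"
    if ab: "a\<^sup>2 + b\<^sup>2 = 1" "3 * e \<le> b" "r * sqrt (2 - 2 * a) \<le> R" for a b
  proof -
    define k where "k = sqrt (2 - 2 * a)"
    have "0 < b\<^sup>2" using ab(2) e_pos by auto
    then have "a\<^sup>2 < 1" using ab(1) by linarith
    then have a1: "\<bar>a\<bar> < 1" by (simp add: abs_square_less_1)
    have k: "0 < k" "k\<^sup>2 = 2 - 2 * a" using a1 by (auto simp: k_def)
    define N where "N = n y (r * k)"
    have s: "0 < r * k" "r * k \<le> R" using k r ab(3) by (auto simp: k_def)
    have spl: "splits_circle \<Omega> y (r * k) e N" using split[OF y s] by (simp add: N_def)
    have aum: "\<bar>a * (u \<bullet> m)\<bar> \<le> e"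
      using mult_mono[of "\<bar>a\<bar>" 1 "\<bar>u \<bullet> m\<bar>" e] a1 um e_pos by (simp add: abs_mult)
    have b9: "27/10 * e \<le> b * (\<nu> \<bullet> m)"
    proof -
      have "3 * e * (9/10) \<le> b * (\<nu> \<bullet> m)"
        using ab(2) m\<nu>9 e_pos by (intro mult_mono) (auto simp: inner_commute)
      then show ?thesis by simp
    qed
    have nq: "norm (a *\<^sub>R u + c *\<^sub>R \<nu>) = 1" if "c\<^sup>2 = b\<^sup>2" for c
      using uu u\<nu> ab(1) that
      by (simp add: norm_eq_1 inner_add inner_commute[of \<nu> u] power2_eq_square)
    have nw: "norm ((1 / k) *\<^sub>R ((a - 1) *\<^sub>R u + c *\<^sub>R \<nu>)) = 1" if "c\<^sup>2 = b\<^sup>2" for c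
    proof -
      have "((a - 1) *\<^sub>R u + c *\<^sub>R \<nu>) \<bullet> ((a - 1) *\<^sub>R u + c *\<^sub>R \<nu>) = k\<^sup>2"
        using uu u\<nu> ab(1) that k
        by (simp add: inner_add inner_commute[of \<nu> u] power2_eq_square algebra_simps)
      then have "(norm ((a - 1) *\<^sub>R u + c *\<^sub>R \<nu>))\<^sup>2 = k\<^sup>2" by (simp add: power2_norm_eq_inner)
      then have "norm ((a - 1) *\<^sub>R u + c *\<^sub>R \<nu>) = k"
        by (rule power2_eq_imp_eq) (use k in auto)
      then show ?thesis using k by simp
    qed
    have eq: "x + r *\<^sub>R (a *\<^sub>R u + c *\<^sub>R \<nu>) = y + (r * k) *\<^sub>R ((1 / k) *\<^sub>R ((a - 1) *\<^sub>R u + c *\<^sub>R \<nu>))" for c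
      using u(2) k by (simp add: algebra_simps)
    have "e < (a *\<^sub>R u + b *\<^sub>R \<nu>) \<bullet> m" using aum b9 e_pos by (simp add: inner_add)
    then have "x + r *\<^sub>R (a *\<^sub>R u + b *\<^sub>R \<nu>) \<in> \<Omega>"
      using splits_circle_in[OF split[OF x r(2,3)] nq[of b]] by (simp add: m_def)
    then have "\<not> ((1 / k) *\<^sub>R ((a - 1) *\<^sub>R u + b *\<^sub>R \<nu>)) \<bullet> N < - e"
      using splits_circle_out[OF spl nw[of b]] closure_subset unfolding eq by blast
    then have A: "- e * k \<le> (a - 1) * (u \<bullet> N) + b * (\<nu> \<bullet> N)"
      by (simp only: inner_scaleR_left inner_add_left times_divide_eq_left mult_1_left
          not_less pos_le_divide_eq[OF k(1)])
    have "(a *\<^sub>R u + (-b) *\<^sub>R \<nu>) \<bullet> m < - e" using aum b9 e_pos by (simp add: inner_diff_left)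
    then have "x + r *\<^sub>R (a *\<^sub>R u + (-b) *\<^sub>R \<nu>) \<notin> closure \<Omega>"
      using splits_circle_out[OF split[OF x r(2,3)] nq[of "-b"]] by (simp add: m_def)
    then have "\<not> e < ((1 / k) *\<^sub>R ((a - 1) *\<^sub>R u + (-b) *\<^sub>R \<nu>)) \<bullet> N"
      using splits_circle_in[OF spl nw[of "-b"]] closure_subset unfolding eq by force
    then have B: "(a - 1) * (u \<bullet> N) - b * (\<nu> \<bullet> N) \<le> e * k"
      by (simp only: inner_scaleR_left inner_add_left times_divide_eq_left mult_1_left
          not_less pos_divide_le_eq[OF k(1)])
    have "(1 - a) * \<bar>N \<bullet> u\<bar> = \<bar>(a - 1) * (u \<bullet> N)\<bar>"
      using a1 by (simp add: abs_mult inner_commute)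
    with A B have "(1 - a) * \<bar>N \<bullet> u\<bar> - e * k \<le> b * (\<nu> \<bullet> N)" by linarith
    then show ?thesis by (simp add: N_def k_def inner_commute)
  qed
  show thesis by (rule that[OF u \<nu> 1 2])
qed

lemma unit_coordinates:
  assumes "norm u = 1" "\<nu> = \<i> * u \<or> \<nu> = - (\<i> * u)" "norm N = 1"
  shows "(N \<bullet> u)\<^sup>2 + (N \<bullet> \<nu>)\<^sup>2 = 1"
  using frame_norm[OF assms(1), of N] assms(2,3) by auto

lemma close_to_perp:
  assumes "norm u = 1" "\<nu> = \<i> * u \<or> \<nu> = - (\<i> * u)" "norm N = 1" "\<bar>N \<bullet> u\<bar> \<le> d" "0 \<le> N \<bullet> \<nu>"
  shows "norm (N - \<nu>) \<le> 3/2 * d"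
proof (rule norm_diff_unit_le)
  show "norm \<nu> = 1" using assms by (auto simp: norm_mult)
  show "\<bar>N \<bullet> (\<i> * \<nu>)\<bar> \<le> d" using assms by (auto simp: mult.assoc[symmetric])
qed (use assms in auto)

text \<open>At equal radii, \<open>a = 1/2\<close>, the inequality excludes that the two circles have opposite normals, so
  that both normals are close to the same unit vector \<open>\<nu>\<close> orthogonal to \<open>y - x\<close>.\<close>

lemma two_circles_normal:
  assumes x: "x \<in> frontier \<Omega>" and y: "y \<in> frontier \<Omega>" and r: "norm (y - x) = r" "0 < r" "r \<le> R"
  obtains u \<nu> where "norm u = 1" "y - x = r *\<^sub>R u" "\<nu> = \<i> * u \<or> \<nu> = - (\<i> * u)"
    "norm (n x r - \<nu>) \<le> 3/2 * e" "norm (n y r - \<nu>) \<le> 3/2 * e"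
    "\<And>a b. a\<^sup>2 + b\<^sup>2 = 1 \<Longrightarrow> 3 * e \<le> b \<Longrightarrow> r * sqrt (2 - 2 * a) \<le> R \<Longrightarrow>
       (1 - a) * \<bar>n y (r * sqrt (2 - 2 * a)) \<bullet> u\<bar> - e * sqrt (2 - 2 * a)
         \<le> b * (n y (r * sqrt (2 - 2 * a)) \<bullet> \<nu>)"
proof -
  from two_circles[OF assms] obtain u \<nu> where u: "norm u = 1" "y - x = r *\<^sub>R u"
    and \<nu>: "\<nu> = \<i> * u \<or> \<nu> = - (\<i> * u)" and 1: "norm (n x r - \<nu>) \<le> 3/2 * e"
    and 2: "\<And>a b. a\<^sup>2 + b\<^sup>2 = 1 \<Longrightarrow> 3 * e \<le> b \<Longrightarrow> r * sqrt (2 - 2 * a) \<le> R \<Longrightarrow>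
       (1 - a) * \<bar>n y (r * sqrt (2 - 2 * a)) \<bullet> u\<bar> - e * sqrt (2 - 2 * a)
         \<le> b * (n y (r * sqrt (2 - 2 * a)) \<bullet> \<nu>)"
    by blast
  define N where "N = n y r"
  have N: "norm N = 1" using norm_normal[OF y r(2,3)] by (simp add: N_def)
  have "\<bar>(x - y) \<bullet> N\<bar> \<le> e * r"
    using frontier_near[OF y x _ r(2,3)] r(1) by (simp add: norm_minus_commute N_def)
  moreover have "x - y = - (r *\<^sub>R u)" using u(2) by (simp add: algebra_simps)
  ultimately have uN: "\<bar>N \<bullet> u\<bar> \<le> e" using r by (simp add: abs_mult mult.commute inner_commute)
  have s1: "1 \<le> sqrt 3" by simp
  have s3: "sqrt 3 / 2 \<ge> 3 * e" using e_small s1 by linarith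
  have "(1/2) * \<bar>N \<bullet> u\<bar> - e \<le> (sqrt 3 / 2) * (N \<bullet> \<nu>)"
    using 2[of "1/2" "sqrt 3 / 2"] s3 r by (simp add: power_divide N_def)
  then have lo: "- e \<le> (sqrt 3 / 2) * (N \<bullet> \<nu>)" by linarith
  \<comment> \<open>A unit vector that is almost orthogonal to \<open>u\<close> is close to \<open>\<nu>\<close> or to \<open>- \<nu>\<close>; \<open>lo\<close> excludes the latter.\<close>
  have "0 \<le> N \<bullet> \<nu>"
  proof (rule ccontr)
    assume neg: "\<not> 0 \<le> N \<bullet> \<nu>"
    have "(N \<bullet> u)\<^sup>2 \<le> (1/2)\<^sup>2"
      using uN e_small by (intro power2_le_iff_abs_le[THEN iffD2]) auto
    with unit_coordinates[OF u(1) \<nu> N] have "(1/2)\<^sup>2 \<le> (- (N \<bullet> \<nu>))\<^sup>2"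
      by (simp add: power2_eq_square)
    then have "1/2 \<le> - (N \<bullet> \<nu>)" by (rule power2_le_imp_le) (use neg in simp)
    then have "1/2 * (1/2) \<le> (sqrt 3 / 2) * (- (N \<bullet> \<nu>))"
      using s1 by (intro mult_mono) auto
    with lo e_small show False by simp
  qed
  from close_to_perp[OF u(1) \<nu> N uN this] have "norm (n y r - \<nu>) \<le> 3/2 * e" by (simp add: N_def)
  from that[OF u \<nu> 1 this 2] show thesis .
qed

lemma nearby_normals:
  assumes "x \<in> frontier \<Omega>" "y \<in> frontier \<Omega>" "norm (y - x) = r" "0 < r" "r \<le> R"
  shows "norm (n x r - n y r) \<le> 3 * e"
proof -
  from two_circles_normal[OF assms] obtain \<nu> where
    "norm (n x r - \<nu>) \<le> 3/2 * e" "norm (n y r - \<nu>) \<le> 3/2 * e" by metis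
  then show ?thesis using norm_triangle_ineq4[of "n x r - \<nu>" "n y r - \<nu>"] by simp
qed

text \<open>The ratio of the radii for which \<open>b\<close> has the least admissible value \<open>3 * e\<close>. It is slightly smaller
  than \<open>2\<close>.\<close>

definition \<kappa> :: real where "\<kappa> = sqrt (2 + 2 * sqrt (1 - 9 * e\<^sup>2))"

lemma e2_small: "9 * e\<^sup>2 \<le> 1/1000000"
proof -
  have "e\<^sup>2 \<le> (1/10000)\<^sup>2" using e_pos e_small by (intro power_mono) auto
  then show ?thesis by (simp add: power2_eq_square)
qed

lemma kappa_bounds: "1999/1000 \<le> \<kappa>" "\<kappa> \<le> 2"
proof -
  have "999/1000 \<le> sqrt (1 - 9 * e\<^sup>2)"
    by (rule real_le_rsqrt) (use e2_small in \<open>simp add: power2_eq_square\<close>)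
  moreover have "sqrt (1 - 9 * e\<^sup>2) \<le> 1" by simp
  ultimately have 1: "(1999/1000)\<^sup>2 \<le> 2 + 2 * sqrt (1 - 9 * e\<^sup>2)" and 2: "2 + 2 * sqrt (1 - 9 * e\<^sup>2) \<le> 2\<^sup>2"
    by (auto simp: power2_eq_square)
  show "1999/1000 \<le> \<kappa>" using 1 unfolding \<kappa>_def by (rule real_le_rsqrt)
  show "\<kappa> \<le> 2" unfolding \<kappa>_def using real_sqrt_le_mono[OF 2] by simp
qed

text \<open>If the smaller circle about \<open>x\<close> is almost internally tangent to the larger one about \<open>y\<close>, that is, if
  \<open>b\<close> is as small as the threshold permits, the inequality of the two circles leaves hardly any
  freedom for the normal of the larger circle.\<close>

lemma doubling:
  assumes y: "y \<in> frontier \<Omega>" and r: "0 < r" "\<kappa> * r \<le> R"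
  shows "norm (n y (\<kappa> * r) - n y r) \<le> 8 * e"
proof -
  have "r \<le> \<kappa> * r" using kappa_bounds r by simp
  then have rR: "r \<le> R" using r(2) by (rule order_trans)
  obtain x where x: "x \<in> frontier \<Omega>" "norm (x - y) = r"
    using frontier_point[OF y r(1) rR] by blast
  from two_circles_normal[OF x(1) y _ r(1) rR] x(2)
  obtain u \<nu> where u: "norm u = 1" and \<nu>: "\<nu> = \<i> * u \<or> \<nu> = - (\<i> * u)"
    and 1: "norm (n y r - \<nu>) \<le> 3/2 * e"
    and 2: "\<And>a b. a\<^sup>2 + b\<^sup>2 = 1 \<Longrightarrow> 3 * e \<le> b \<Longrightarrow> r * sqrt (2 - 2 * a) \<le> R \<Longrightarrow>
       (1 - a) * \<bar>n y (r * sqrt (2 - 2 * a)) \<bullet> u\<bar> - e * sqrt (2 - 2 * a)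
         \<le> b * (n y (r * sqrt (2 - 2 * a)) \<bullet> \<nu>)"
    by (metis norm_minus_commute)
  define N where "N = n y (\<kappa> * r)"
  have N: "norm N = 1" using norm_normal[OF y _ r(2)] r kappa_bounds by (simp add: N_def)
  define a where "a = - sqrt (1 - 9 * e\<^sup>2)"
  have a2: "a\<^sup>2 = 1 - 9 * e\<^sup>2" using e2_small by (simp add: a_def)
  have lam: "sqrt (2 - 2 * a) = \<kappa>" by (simp add: \<kappa>_def a_def)
  have "999/1000 \<le> sqrt (1 - 9 * e\<^sup>2)"
    by (rule real_le_rsqrt) (use e2_small in \<open>simp add: power2_eq_square\<close>)
  then have a9: "19/10 \<le> 1 - a" by (simp add: a_def)
  have main: "(1 - a) * \<bar>N \<bullet> u\<bar> - e * \<kappa> \<le> 3 * e * (N \<bullet> \<nu>)"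
    using 2[of a "3 * e"] a2 r unfolding lam by (simp add: N_def power_mult_distrib mult.commute)
  have "norm \<nu> = 1" using \<nu> u by (auto simp: norm_mult)
  then have N\<nu>: "N \<bullet> \<nu> \<le> 1" using Cauchy_Schwarz_ineq2[of N \<nu>] N by simp
  have "19/10 * \<bar>N \<bullet> u\<bar> \<le> (1 - a) * \<bar>N \<bullet> u\<bar>" using a9 by (intro mult_right_mono) auto
  moreover have "3 * e * (N \<bullet> \<nu>) \<le> 3 * e * 1" using N\<nu> e_pos by (intro mult_left_mono) auto
  moreover have "e * \<kappa> \<le> e * 2" using kappa_bounds e_pos by (intro mult_left_mono) auto
  ultimately have Nu: "\<bar>N \<bullet> u\<bar> \<le> 3 * e" using main e_pos by linarith
  have "0 \<le> (1 - a) * \<bar>N \<bullet> u\<bar>" using a9 by simp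
  then have "- (2 * e) \<le> 3 * e * (N \<bullet> \<nu>)" using main \<open>e * \<kappa> \<le> e * 2\<close> by linarith
  then have lo: "- 2 \<le> 3 * (N \<bullet> \<nu>)"
    using e_pos mult_le_cancel_left_pos[of e "-2" "3 * (N \<bullet> \<nu>)"] by (simp add: algebra_simps)
  have "0 \<le> N \<bullet> \<nu>"
  proof (rule ccontr)
    assume neg: "\<not> 0 \<le> N \<bullet> \<nu>"
    have "(N \<bullet> u)\<^sup>2 \<le> (1/10)\<^sup>2"
      using Nu e_small by (intro power2_le_iff_abs_le[THEN iffD2]) auto
    with unit_coordinates[OF u(1) \<nu> N] have "(9/10)\<^sup>2 \<le> (- (N \<bullet> \<nu>))\<^sup>2"
      by (simp add: power2_eq_square)
    then have "9/10 \<le> - (N \<bullet> \<nu>)" by (rule power2_le_imp_le) (use neg in simp)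
    with lo show False by simp
  qed
  from close_to_perp[OF u \<nu> N Nu this] have "norm (N - \<nu>) \<le> 9/2 * e" by simp
  with 1 show ?thesis
    using norm_triangle_ineq4[of "N - \<nu>" "n y r - \<nu>"] e_pos by (simp add: N_def)
qed

text \<open>For \<open>s\<close> up to \<open>19/10 * r\<close> the same inequality is much weaker, but it keeps the normal away from the
  orthogonal direction. This rules out that the boundary winds around \<open>y\<close> between the two radii.\<close>

lemma comparable:
  assumes y: "y \<in> frontier \<Omega>" and r: "0 < r" "r \<le> s" "s \<le> 19/10 * r" "s \<le> R"
  shows "2/5 \<le> n y s \<bullet> n y r"
proof -
  have rR: "r \<le> R" using r by simp
  obtain x where x: "x \<in> frontier \<Omega>" "norm (x - y) = r"
    using frontier_point[OF y r(1) rR] by blast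
  from two_circles_normal[OF x(1) y _ r(1) rR] x(2)
  obtain u \<nu> where u: "norm u = 1" and \<nu>: "\<nu> = \<i> * u \<or> \<nu> = - (\<i> * u)"
    and 1: "norm (n y r - \<nu>) \<le> 3/2 * e"
    and 2: "\<And>a b. a\<^sup>2 + b\<^sup>2 = 1 \<Longrightarrow> 3 * e \<le> b \<Longrightarrow> r * sqrt (2 - 2 * a) \<le> R \<Longrightarrow>
       (1 - a) * \<bar>n y (r * sqrt (2 - 2 * a)) \<bullet> u\<bar> - e * sqrt (2 - 2 * a)
         \<le> b * (n y (r * sqrt (2 - 2 * a)) \<bullet> \<nu>)"
    by (metis norm_minus_commute)
  define N where "N = n y s"
  have N: "norm N = 1" using norm_normal[OF y _ r(4)] r by (simp add: N_def)
  define k where "k = s / r"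
  have k: "1 \<le> k" "k \<le> 19/10" "r * k = s" using r by (auto simp: k_def field_simps)
  define a where "a = 1 - k\<^sup>2 / 2"
  have "1\<^sup>2 \<le> k\<^sup>2" "k\<^sup>2 \<le> (19/10)\<^sup>2" using k by (intro power_mono; simp)+
  then have a: "- (161/200) \<le> a" "a \<le> 1/2" by (auto simp: a_def power2_eq_square)
  then have "\<bar>a\<bar> \<le> 81/100" by linarith
  then have "a\<^sup>2 \<le> (81/100)\<^sup>2" by (simp add: power2_le_iff_abs_le)
  then have a2: "a\<^sup>2 \<le> 3/4" by (simp add: power2_eq_square)
  have kk: "sqrt (2 - 2 * a) = k" using k by (simp add: a_def)
  define b where "b = sqrt (1 - a\<^sup>2)"
  have b2: "a\<^sup>2 + b\<^sup>2 = 1" using a2 by (simp add: b_def)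
  have b: "1/2 \<le> b" "b \<le> 1" unfolding b_def
    by (rule real_le_rsqrt) (use a2 in \<open>simp_all add: power2_eq_square\<close>)
  have main: "(1 - a) * \<bar>N \<bullet> u\<bar> - e * k \<le> b * (N \<bullet> \<nu>)"
    using 2[OF b2] r k b e_small unfolding kk by (simp add: N_def)
  have "1/2 * \<bar>N \<bullet> u\<bar> \<le> (1 - a) * \<bar>N \<bullet> u\<bar>" using a by (intro mult_right_mono) auto
  moreover have "e * k \<le> e * 2" using k e_pos by (intro mult_left_mono) auto
  ultimately have main: "1/2 * \<bar>N \<bullet> u\<bar> - e * 2 \<le> b * (N \<bullet> \<nu>)" using main by linarith
  have "41/100 \<le> N \<bullet> \<nu>"
  proof (rule ccontr)
    assume neg: "\<not> 41/100 \<le> N \<bullet> \<nu>"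
    have "b * (N \<bullet> \<nu>) \<le> b * (41/100)" using neg b by (intro mult_left_mono) auto
    then have "\<bar>N \<bullet> u\<bar> \<le> 83/100" using main b e_small by linarith
    then have "(N \<bullet> u)\<^sup>2 \<le> (83/100)\<^sup>2" by (simp add: power2_le_iff_abs_le)
    then have "(1/2)\<^sup>2 \<le> (N \<bullet> \<nu>)\<^sup>2"
      using unit_coordinates[OF u \<nu> N] by (simp add: power2_eq_square)
    then have "1/2 \<le> \<bar>N \<bullet> \<nu>\<bar>" by (simp add: abs_le_square_iff[symmetric])
    with neg have "1/2 \<le> - (N \<bullet> \<nu>)" by linarith
    then have "1/2 * (1/2) \<le> b * (- (N \<bullet> \<nu>))" using b by (intro mult_mono) auto
    with main e_small show False by simp
  qed
  moreover have "\<bar>N \<bullet> (n y r - \<nu>)\<bar> \<le> 3/2 * e"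
    using Cauchy_Schwarz_ineq2[of N "n y r - \<nu>"] N 1 by simp
  moreover have "N \<bullet> n y r = N \<bullet> \<nu> + N \<bullet> (n y r - \<nu>)" by (simp add: inner_diff_right)
  ultimately show ?thesis using e_small by (simp add: N_def)
qed

text \<open>The case of larger \<open>s\<close> reduces to the previous one by halving the radius.\<close>

lemma comparable3:
  assumes y: "y \<in> frontier \<Omega>" and h: "0 < h" "h \<le> s" "s \<le> 3 * h" "s \<le> R"
  shows "3/10 \<le> n y s \<bullet> n y h"
proof (cases "s \<le> 19/10 * h")
  case True
  then show ?thesis using comparable[OF y h(1,2) True h(4)] by simp
next
  case False
  define r where "r = s / \<kappa>"
  have lam: "0 < \<kappa>" using kappa_bounds by simp
  have s: "s = \<kappa> * r" using lam by (simp add: r_def)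
  have "0 < s" using h by simp
  have "s / 2 \<le> r" unfolding r_def using kappa_bounds \<open>0 < s\<close> by (intro divide_left_mono) auto
  moreover have "r \<le> s / (1999/1000)"
    unfolding r_def using kappa_bounds \<open>0 < s\<close> by (intro divide_left_mono) auto
  ultimately have r: "95/100 * h \<le> r" "r \<le> 16/10 * h" "r \<le> s"
    using False h \<open>0 < s\<close> by auto
  have r0: "0 < r" using r h by simp
  have "2/5 \<le> n y r \<bullet> n y h"
  proof (cases "h \<le> r")
    case True
    then show ?thesis using comparable[OF y h(1) True] r h by simp
  next
    case F: False
    then show ?thesis using comparable[OF y r0, of h] r h by (simp add: inner_commute)
  qed
  moreover have "\<bar>(n y s - n y r) \<bullet> n y h\<bar> \<le> 8 * e"
    using Cauchy_Schwarz_ineq2[of "n y s - n y r" "n y h"] doubling[OF y r0] s h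
      norm_normal[OF y h(1)] by simp
  ultimately show ?thesis using e_small by (simp add: inner_diff_left)
qed

text \<open>The decisive step: a deviation of direction at the radius \<open>s\<close> forces a deviation at another radius
  that is larger by a fixed factor, up to an error proportional to \<open>e\<close>. Put \<open>y\<close> at the origin and let
  \<open>z\<close> and \<open>w\<close> be boundary points at distance \<open>h\<close> and \<open>s\<close>. The reflection \<open>2 * w - z\<close> of \<open>z\<close> about \<open>w\<close> is
  almost a boundary point. It has twice the distance of \<open>w\<close> from the line through \<open>y\<close> and \<open>z\<close>, but
  its norm is less than twice that of \<open>w\<close> by a fixed factor, because the angle between \<open>z\<close> and \<open>w\<close> is not close to a right
  angle. So it is seen under a larger angle.\<close>

lemma sine_step:
  assumes y: "y \<in> frontier \<Omega>" and h: "0 < h" "8 * h \<le> R" and s: "h \<le> s" "s \<le> 3 * h"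
  shows "\<exists>q\<in>{h..3 * h}. \<bar>n y s \<bullet> (\<i> * n y h)\<bar> \<le> 40 * e + 998/1000 * \<bar>n y q \<bullet> (\<i> * n y h)\<bar>"
proof -
  define X Y where "X = \<i> * n y h" and "Y = \<i> * n y s"
  have nh: "norm (n y h) = 1" and ns: "norm (n y s) = 1"
    using norm_normal[OF y] h s by auto
  then have nX: "norm X = 1" and nY: "norm Y = 1" by (auto simp: X_def Y_def norm_mult)
  then have XX: "X \<bullet> X = 1" "Y \<bullet> Y = 1" by (simp_all add: norm_eq_1)
  have c: "3/10 \<le> X \<bullet> Y"
    using comparable3[OF y h(1) s] h s by (simp add: X_def Y_def inner_commute)
  have c1: "X \<bullet> Y \<le> 1" using Cauchy_Schwarz_ineq2[of X Y] nX nY by simp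
  obtain z where z: "z \<in> frontier \<Omega>" "norm (z - y) = h" "norm (z - y - h *\<^sub>R X) \<le> 3/2 * e * h"
    using frontier_point[OF y h(1), of X] h by (auto simp: X_def)
  obtain w where w: "w \<in> frontier \<Omega>" "norm (w - y) = s" "norm (w - y - s *\<^sub>R Y) \<le> 3/2 * e * s"
    using frontier_point[OF y, of s Y] h s by (auto simp: Y_def)
  have zw: "norm (z - w) \<le> 4 * h"
    using norm_triangle_ineq4[of "z - y" "w - y"] z(2) w(2) s by simp
  then obtain v where v: "v \<in> frontier \<Omega>" "norm (v - (2 * w - z)) \<le> 3 * e * norm (z - w)"
    using frontier_reflect[OF z(1) w(1)] h by force
  have "3 * e * norm (z - w) \<le> 3 * e * (4 * h)" using zw e_pos by (intro mult_left_mono) auto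
  with v have v2: "norm (v - (2 * w - z)) \<le> 12 * (e * h)" by simp
  have es: "e * s \<le> 3 * (e * h)" using s mult_left_mono[OF s(2), of e] e_pos by simp
  \<comment> \<open>\<open>V\<close> is the position of the reflected point if \<open>z\<close> and \<open>w\<close> lie exactly on the axes \<open>X\<close> and \<open>Y\<close>.\<close>
  define V where "V = (2 * s) *\<^sub>R Y - h *\<^sub>R X"
  have "v - y - V = (v - (2 * w - z)) + 2 *\<^sub>R (w - y - s *\<^sub>R Y) - (z - y - h *\<^sub>R X)"
    by (simp add: V_def scaleR_conv_of_real algebra_simps)
  also have "norm \<dots> \<le> norm (v - (2 * w - z)) + norm (2 *\<^sub>R (w - y - s *\<^sub>R Y)) + norm (z - y - h *\<^sub>R X)"
    by (rule order_trans[OF norm_triangle_ineq4 add_right_mono[OF norm_triangle_ineq]])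
  also have "\<dots> \<le> 12 * (e * h) + 3 * (e * s) + 3/2 * (e * h)" using v2 w(3) z(3) by simp
  finally have vV: "norm (v - y - V) \<le> 25 * (e * h)"
    using es mult_pos_pos[OF e_pos h(1)] by linarith
  have eh: "0 < e * h" "e * h \<le> h / 10000" using e_pos h mult_right_mono[OF e_small, of h] by auto
  have hh: "0 < h * h" "h * h \<le> s * h" "s * s \<le> 9 * (h * h)"
    using h s mult_mono[OF s(2) s(2)] by auto
  have V2: "(norm V)\<^sup>2 = 4 * (s * s) + h * h - 4 * (s * h) * (X \<bullet> Y)"
    unfolding V_def power2_norm_eq_inner using XX
    by (simp add: inner_diff inner_commute[of Y X] algebra_simps)
  \<comment> \<open>The gain: \<open>X \<bullet> Y \<ge> 3/10 > 1/4\<close> makes \<open>norm V\<close> smaller than \<open>2 * s\<close> by a definite factor.\<close>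
  have "s * h * (3/10) \<le> s * h * (X \<bullet> Y)" using c hh by (intro mult_left_mono) auto
  then have "(norm V)\<^sup>2 \<le> (1996/1000 * s)\<^sup>2" using V2 hh by (simp add: power2_eq_square)
  then have Vs: "norm V \<le> 1996/1000 * s" by (rule power2_le_imp_le) (use h s in simp)
  have "s * h * (X \<bullet> Y) \<le> s * h * 1" using c1 hh by (intro mult_left_mono) auto
  then have "(2 * s - h)\<^sup>2 \<le> (norm V)\<^sup>2" using V2 by (simp add: power2_eq_square algebra_simps)
  then have "2 * s - h \<le> norm V" by (rule power2_le_imp_le) simp
  then have Vh: "h \<le> norm V" using s by simp
  define q where "q = norm (v - y)"
  have q: "q \<le> norm V + 25 * (e * h)" "norm V \<le> q + 25 * (e * h)"
    using norm_triangle_ineq[of "v - y - V" V] norm_triangle_ineq4[of "v - y" "v - y - V"] vV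
    by (auto simp: q_def)
  have q': "9975/10000 * h \<le> q" "q \<le> 5991/1000 * h" using q Vh Vs s eh by auto
  have q0: "0 < q" "q \<le> R" using q' h by auto
  have lam0: "0 < \<kappa>" using kappa_bounds by simp
  \<comment> \<open>The distance \<open>q\<close> of \<open>v\<close> may leave the range \<open>[h, 3 * h]\<close> on both sides, but one
    multiplication or division by \<open>\<kappa>\<close> brings it back and hardly changes the normal.\<close>
  obtain q1 where q1: "h \<le> q1" "q1 \<le> 3 * h" "norm (n y q1 - n y q) \<le> 8 * e"
  proof -
    consider "q < h" | "h \<le> q" "q \<le> 3 * h" | "3 * h < q" by linarith
    then show thesis
    proof cases
      case 1
      have "1999/1000 * q \<le> \<kappa> * q" "\<kappa> * q \<le> 2 * q"
        using kappa_bounds q0 by (intro mult_right_mono; simp)+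
      then have "h \<le> \<kappa> * q" "\<kappa> * q \<le> 3 * h" using 1 q' h by linarith+
      then show thesis using that[of "\<kappa> * q"] doubling[OF y q0(1)] h by simp
    next
      case 2
      then show thesis using that[of q] e_pos by simp
    next
      case 3
      have "q / 2 \<le> q / \<kappa>" "q / \<kappa> \<le> q / (1999/1000)"
        using kappa_bounds q0 by (intro divide_left_mono; simp)+
      then have a: "h \<le> q / \<kappa>" "q / \<kappa> \<le> 3 * h" using 3 q' h by auto
      have "\<kappa> * (q / \<kappa>) = q" using lam0 by simp
      then show thesis using that[OF a] doubling[OF y, of "q / \<kappa>"] a h q0
        by (simp add: norm_minus_commute)
    qed
  qed
  define N where "N = n y q1"
  have nN: "norm N = 1" using norm_normal[OF y, of q1] q1 h by (simp add: N_def)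
  have nq: "norm (n y q) = 1" using norm_normal[OF y q0] .
  have "\<bar>(v - y) \<bullet> n y q\<bar> \<le> e * q"
    using frontier_near[OF y v(1) _ q0] by (simp add: q_def)
  moreover have "e * q \<le> 6 * (e * h)" using mult_left_mono[OF q'(2), of e] eh e_pos by simp
  moreover have "\<bar>(v - y - V) \<bullet> n y q\<bar> \<le> 25 * (e * h)"
    using Cauchy_Schwarz_ineq2[of "v - y - V" "n y q"] vV nq by simp
  moreover have "\<bar>V \<bullet> (N - n y q)\<bar> \<le> 48 * (e * h)"
  proof -
    have "\<bar>V \<bullet> (N - n y q)\<bar> \<le> norm V * norm (N - n y q)" by (rule Cauchy_Schwarz_ineq2)
    also have "\<dots> \<le> 6 * h * (8 * e)"
      using Vs s q1 h by (intro mult_mono) (auto simp: N_def)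
    finally show ?thesis by (simp add: mult.commute[of e h])
  qed
  moreover have "V \<bullet> N = (v - y) \<bullet> n y q - (v - y - V) \<bullet> n y q + V \<bullet> (N - n y q)"
    by (simp add: inner_diff)
  ultimately have VN: "\<bar>V \<bullet> N\<bar> \<le> 79 * (e * h)" by linarith
  \<comment> \<open>The distance of \<open>V\<close> from the axis \<open>X\<close>, computed in two ways: from the definition of \<open>V\<close>, and from
    the fact that \<open>V\<close> is almost orthogonal to \<open>N\<close>.\<close>
  have "V \<bullet> n y h = 2 * s * (Y \<bullet> n y h)" by (simp add: V_def inner_diff_left X_def)
  also have "Y \<bullet> n y h = - (n y s \<bullet> (\<i> * n y h))" by (simp add: Y_def inner_complex_def)
  finally have "\<bar>V \<bullet> n y h\<bar> = 2 * s * \<bar>n y s \<bullet> (\<i> * n y h)\<bar>" using h s by (simp add: abs_mult)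
  moreover have "V \<bullet> n y h = (V \<bullet> N) * (n y h \<bullet> N) + (V \<bullet> (\<i> * N)) * (n y h \<bullet> (\<i> * N))"
    by (rule frame_inner[OF nN])
  moreover have "\<bar>(V \<bullet> N) * (n y h \<bullet> N)\<bar> \<le> 79 * (e * h) * 1"
    unfolding abs_mult using VN Cauchy_Schwarz_ineq2[of "n y h" N] nh nN eh
    by (intro mult_mono) auto
  moreover have "\<bar>(V \<bullet> (\<i> * N)) * (n y h \<bullet> (\<i> * N))\<bar> \<le> 1996/1000 * s * \<bar>N \<bullet> (\<i> * n y h)\<bar>"
  proof -
    have eq: "\<bar>n y h \<bullet> (\<i> * N)\<bar> = \<bar>N \<bullet> (\<i> * n y h)\<bar>" by (simp add: inner_complex_def) argo
    have le: "\<bar>V \<bullet> (\<i> * N)\<bar> \<le> 1996/1000 * s"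
      using Cauchy_Schwarz_ineq2[of V "\<i> * N"] nN Vs by (simp add: norm_mult)
    show ?thesis unfolding abs_mult eq by (rule mult_right_mono[OF le abs_ge_zero])
  qed
  ultimately have "2 * s * \<bar>n y s \<bullet> (\<i> * n y h)\<bar> \<le> 79 * (e * h) + 1996/1000 * s * \<bar>N \<bullet> (\<i> * n y h)\<bar>"
    by linarith
  also have "\<dots> \<le> 2 * s * (40 * e + 998/1000 * \<bar>N \<bullet> (\<i> * n y h)\<bar>)"
    using mult_left_mono[OF s(1), of e] e_pos eh by (simp add: algebra_simps)
  finally have "\<bar>n y s \<bullet> (\<i> * n y h)\<bar> \<le> 40 * e + 998/1000 * \<bar>N \<bullet> (\<i> * n y h)\<bar>"
    using h s by simp
  with q1 show ?thesis by (intro bexI[of _ q1]) (auto simp: N_def)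
qed

text \<open>Hence the supremum of all deviations over the radii in \<open>[h, 3 * h]\<close> is bounded by a contraction of
  itself plus a multiple of \<open>e\<close>.\<close>

lemma normal_stable:
  assumes y: "y \<in> frontier \<Omega>" and h: "0 < h" "8 * h \<le> R" and s: "h \<le> s" "s \<le> 3 * h"
  shows "norm (n y s - n y h) \<le> 30000 * e"
proof -
  define S where "S t = \<bar>n y t \<bullet> (\<i> * n y h)\<bar>" for t
  have nrm: "norm (n y t) = 1" if "t \<in> {h..3 * h}" for t
    using norm_normal[OF y, of t] that h by auto
  have S1: "S t \<le> 1" if "t \<in> {h..3 * h}" for t
    using Cauchy_Schwarz_ineq2[of "n y t" "\<i> * n y h"] nrm[OF that] nrm[of h] h
    by (simp add: S_def norm_mult)
  then have bdd: "bdd_above (S ` {h..3 * h})" by (intro bdd_aboveI2)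
  have ne: "{h..3 * h} \<noteq> {}" using h by simp
  define \<Sigma> where "\<Sigma> = (SUP t\<in>{h..3 * h}. S t)"
  have "\<Sigma> \<le> 40 * e + 998/1000 * \<Sigma>"
    unfolding \<Sigma>_def
  proof (rule cSUP_least[OF ne])
    fix t assume "t \<in> {h..3 * h}"
    then obtain q where q: "q \<in> {h..3 * h}" "S t \<le> 40 * e + 998/1000 * S q"
      using sine_step[OF y h, of t] by (auto simp: S_def)
    have "S q \<le> (SUP t\<in>{h..3 * h}. S t)" by (rule cSUP_upper[OF q(1) bdd])
    with q(2) show "S t \<le> 40 * e + 998/1000 * (SUP t\<in>{h..3 * h}. S t)" by linarith
  qed
  then have "\<Sigma> \<le> 20000 * e" by simp
  moreover have "S s \<le> \<Sigma>" unfolding \<Sigma>_def by (rule cSUP_upper[OF _ bdd]) (use s in simp)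
  ultimately have "\<bar>n y s \<bullet> (\<i> * n y h)\<bar> \<le> 20000 * e" by (simp add: S_def)
  moreover have "0 \<le> n y s \<bullet> n y h" using comparable3[OF y h(1) s] h s by simp
  ultimately show ?thesis using norm_diff_unit_le[of "n y s" "n y h" "20000 * e"] nrm[of s] nrm[of h] s h
    by simp
qed

end

section \<open>The limit normal\<close>

text \<open>Halving \<open>s\<close> repeatedly, the errors form a geometric series. Its sum does not depend on \<open>f\<close>, which
  gives the same constant at all boundary points below.\<close>

lemma geometric_telescope:
  fixes f :: "real \<Rightarrow> 'a::real_normed_vector"
  assumes \<alpha>: "0 < \<alpha>" and A: "0 \<le> A"
    and step: "\<And>h s. 0 < h \<Longrightarrow> h \<le> s \<Longrightarrow> s \<le> 2 * h \<Longrightarrow> s \<le> \<rho> \<Longrightarrow> norm (f s - f h) \<le> A * h powr \<alpha>"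
    and "0 < t" "t \<le> s" "s \<le> \<rho>"
  shows "norm (f t - f s) \<le> A / (1 - 2 powr - \<alpha>) * s powr \<alpha>"
proof -
  define q where "q = (2::real) powr - \<alpha>"
  have q: "0 < q" "q < 1" using \<alpha> by (auto simp: q_def powr_less_one)
  define B where "B = A / (1 - q)"
  have B: "0 \<le> B" "B * q + A = B" using A q by (auto simp: B_def field_simps)
  then have AB: "A \<le> B" using q mult_nonneg_nonneg[of B q] by linarith
  have half: "(s / 2) powr \<alpha> = q * s powr \<alpha>" if "0 < s" for s
    using that by (simp add: q_def powr_divide powr_minus field_simps)
  have "norm (f t - f s) \<le> B * s powr \<alpha>" if "0 < t" "t \<le> s" "s \<le> \<rho>" "s \<le> t * 2 ^ k" for k t s
    using that
  proof (induction k arbitrary: s)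
    case 0
    then have "t = s" by simp
    then show ?case using B by simp
  next
    case (Suc k)
    show ?case
    proof (cases "s \<le> 2 * t")
      case True
      have "norm (f s - f t) \<le> A * t powr \<alpha>" using step[of t s] Suc.prems True by simp
      also have "\<dots> \<le> B * s powr \<alpha>"
        using Suc.prems AB B \<alpha> by (intro mult_mono powr_mono2) auto
      finally show ?thesis by (simp add: norm_minus_commute)
    next
      case False
      have "norm (f t - f (s / 2)) \<le> B * (s / 2) powr \<alpha>"
        using Suc.prems False by (intro Suc.IH) auto
      moreover have "norm (f s - f (s / 2)) \<le> A * (s / 2) powr \<alpha>"
        using Suc.prems by (intro step) auto
      moreover have "A * (s / 2) powr \<alpha> \<le> A * s powr \<alpha>"
        using Suc.prems A \<alpha> by (intro mult_left_mono powr_mono2) auto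
      moreover have "norm (f t - f s) \<le> norm (f t - f (s / 2)) + norm (f s - f (s / 2))"
        using norm_triangle_ineq4[of "f t - f (s / 2)" "f s - f (s / 2)"] by simp
      moreover have "B * (s / 2) powr \<alpha> + A * s powr \<alpha> = (B * q + A) * s powr \<alpha>"
        using half[of s] Suc.prems by (simp add: algebra_simps)
      ultimately show ?thesis using B(2) by simp
    qed
  qed
  moreover obtain k where "s / t < 2 ^ k" using real_arch_pow[of 2 "s / t"] by auto
  then have "s \<le> t * 2 ^ k" using assms(4) by (simp add: field_simps)
  ultimately show ?thesis using assms(4-6) by (simp add: B_def q_def)
qed

lemma limit_at_zero_with_rate:
  fixes f :: "real \<Rightarrow> 'a::banach"
  assumes \<alpha>: "0 < \<alpha>" and \<rho>: "0 < \<rho>" and B: "0 \<le> B"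
    and est: "\<And>t s. 0 < t \<Longrightarrow> t \<le> s \<Longrightarrow> s \<le> \<rho> \<Longrightarrow> norm (f t - f s) \<le> B * s powr \<alpha>"
  shows "\<exists>L. (\<forall>s. 0 < s \<and> s \<le> \<rho> \<longrightarrow> norm (f s - L) \<le> B * s powr \<alpha>) \<and>
    (\<lambda>k. f (\<rho> / real (Suc k))) \<longlonglongrightarrow> L"
proof -
  define t where "t k = \<rho> / real (Suc k)" for k
  have t: "0 < t k" "t k \<le> \<rho>" for k using \<rho> by (auto simp: t_def field_simps)
  have t_mono: "t n \<le> t m" if "m \<le> n" for m n
    using that \<rho> unfolding t_def by (intro divide_left_mono) auto
  have "t \<longlonglongrightarrow> 0" unfolding t_def using LIMSEQ_Suc[OF lim_const_over_n] by auto
  then have "(\<lambda>k. B * t k powr \<alpha>) \<longlonglongrightarrow> B * 0 powr \<alpha>"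
    using \<alpha> t by (intro tendsto_intros tendsto_powr') (auto simp: less_imp_le)
  then have small: "(\<lambda>k. B * t k powr \<alpha>) \<longlonglongrightarrow> 0" by simp
  have "Cauchy (\<lambda>k. f (t k))"
  proof (rule metric_CauchyI)
    fix \<epsilon> :: real assume "0 < \<epsilon>"
    then obtain M where M: "B * t M powr \<alpha> < \<epsilon> / 2"
      using order_tendstoD(2)[OF small, of "\<epsilon> / 2"] by (auto simp: eventually_sequentially)
    have "norm (f (t k) - f (t M)) < \<epsilon> / 2" if "M \<le> k" for k
      using est[of "t k" "t M"] t t_mono[OF that] M by (meson order_le_less_trans)
    then show "\<exists>M. \<forall>m\<ge>M. \<forall>n\<ge>M. dist (f (t m)) (f (t n)) < \<epsilon>"
      by (metis dist_norm dist_triangle_half_l)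
  qed
  then obtain L where L: "(\<lambda>k. f (t k)) \<longlonglongrightarrow> L"
    using Cauchy_convergent convergent_def by blast
  have "norm (f s - L) \<le> B * s powr \<alpha>" if s: "0 < s" "s \<le> \<rho>" for s
  proof (rule tendsto_upperbound)
    show "(\<lambda>k. norm (f s - f (t k))) \<longlonglongrightarrow> norm (f s - L)" by (intro tendsto_intros L)
    have "eventually (\<lambda>k. t k < s) sequentially"
      using order_tendstoD(2)[OF \<open>t \<longlonglongrightarrow> 0\<close>] s by blast
    then show "eventually (\<lambda>k. norm (f s - f (t k)) \<le> B * s powr \<alpha>) sequentially"
    proof eventually_elim
      case (elim k)
      then show ?case using est[of "t k" s] t s by (simp add: norm_minus_commute)
    qed
  qed simp
  with L show ?thesis unfolding t_def by blast
qed

lemma splits_circle_perturb: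
  assumes "splits_circle \<Omega> x r e n" "norm m = 1" "norm (n - m) \<le> d" "e + d \<le> e'"
  shows "splits_circle \<Omega> x r e' m"
  unfolding splits_circle_def
proof (intro conjI allI impI)
  fix v :: complex assume v: "norm v = 1"
  have "\<bar>v \<bullet> (n - m)\<bar> \<le> d" using Cauchy_Schwarz_ineq2[of v "n - m"] v assms(3) by simp
  then have *: "v \<bullet> m - d \<le> v \<bullet> n" "v \<bullet> n \<le> v \<bullet> m + d" by (simp_all add: inner_diff_right)
  show "x + r *\<^sub>R v \<in> \<Omega>" if "e' < v \<bullet> m"
    by (rule splits_circle_in[OF assms(1) v]) (use that * assms(4) in linarith)
  show "x + r *\<^sub>R v \<notin> closure \<Omega>" if "v \<bullet> m < - e'"
    by (rule splits_circle_out[OF assms(1) v]) (use that * assms(4) in linarith)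
qed (rule assms(2))

text \<open>Up to the radius \<open>R\<close>, a threshold decaying like a power of the radius is bounded by its value
  at \<open>R\<close>.\<close>

lemma uniformly_split_of_rate:
  assumes "open \<Omega>" "0 < \<alpha>" "0 < K" "0 < R" "R \<le> r0" "K * R powr \<alpha> \<le> 1/10000"
    and split: "\<And>x r. x \<in> frontier \<Omega> \<Longrightarrow> 0 < r \<Longrightarrow> r \<le> r0 \<Longrightarrow> splits_circle \<Omega> x r (K * r powr \<alpha>) (n x r)"
  shows "uniformly_split \<Omega> n (K * R powr \<alpha>) R"
proof
  fix x r assume *: "x \<in> frontier \<Omega>" "0 < r" "r \<le> R"
  then have "K * r powr \<alpha> \<le> K * R powr \<alpha>"
    using assms by (intro mult_left_mono powr_mono2) auto
  moreover have "splits_circle \<Omega> x r (K * r powr \<alpha>) (n x r)" using split[of x r] * assms(5) by simp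
  ultimately show "splits_circle \<Omega> x r (K * R powr \<alpha>) (n x r)"
    by (auto intro: splits_circle_perturb[where d = 0] dest: splits_circle_norm)
qed (use assms in auto)

text \<open>The normal \<open>N\<close> no longer depends on the radius, and the circles flatten at the rate \<open>r powr \<alpha>\<close>.\<close>

definition holder_normal :: "complex set \<Rightarrow> real \<Rightarrow> real \<Rightarrow> real \<Rightarrow> (complex \<Rightarrow> complex) \<Rightarrow> bool" where
  "holder_normal \<Omega> \<alpha> B \<rho> N \<longleftrightarrow>
     (\<forall>x\<in>frontier \<Omega>. \<forall>r. 0 < r \<and> r \<le> \<rho> \<longrightarrow> splits_circle \<Omega> x r (B * r powr \<alpha>) (N x)) \<and>
     (\<forall>x\<in>frontier \<Omega>. \<forall>y\<in>frontier \<Omega>. norm (y - x) \<le> \<rho> \<longrightarrow>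
        norm (N x - N y) \<le> B * norm (y - x) powr \<alpha>)"

text \<open>The unit normal is the limit of the normals of small circles. Applying the uniform estimates
  with the threshold of the current scale turns errors proportional to the threshold into errors of the
  order \<open>r powr \<alpha>\<close>.\<close>

lemma holder_normal_exists:
  assumes op: "open \<Omega>" and \<alpha>: "0 < \<alpha>" and K: "0 < K" and r0: "0 < r0"
    and split: "\<And>x r. x \<in> frontier \<Omega> \<Longrightarrow> 0 < r \<Longrightarrow> r \<le> r0 \<Longrightarrow> \<exists>n. splits_circle \<Omega> x r (K * r powr \<alpha>) n"
  shows "\<exists>B \<rho> N. 0 < B \<and> 0 < \<rho> \<and> holder_normal \<Omega> \<alpha> B \<rho> N"
proof -
  obtain n where n: "\<And>x r. x \<in> frontier \<Omega> \<Longrightarrow> 0 < r \<Longrightarrow> r \<le> r0 \<Longrightarrow> splits_circle \<Omega> x r (K * r powr \<alpha>) (n x r)"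
    using split by metis
  \<comment> \<open>the largest scale at which the threshold is at most \<open>1/10000\<close>\<close>
  define R where "R = min r0 ((1 / (10000 * K)) powr (1 / \<alpha>))"
  have R: "0 < R" "R \<le> r0" using r0 K by (auto simp: R_def)
  have "R powr \<alpha> \<le> ((1 / (10000 * K)) powr (1 / \<alpha>)) powr \<alpha>"
    using \<alpha> R by (intro powr_mono2) (auto simp: R_def)
  also have "\<dots> = 1 / (10000 * K)" using \<alpha> K by (simp add: powr_powr)
  finally have RK: "K * R powr \<alpha> \<le> 1/10000" using K by (simp add: field_simps)
  have loc: "uniformly_split \<Omega> n (K * s powr \<alpha>) s" if "0 < s" "s \<le> R" for s
  proof (rule uniformly_split_of_rate[OF op \<alpha> K that(1) _ _ n])
    show "s \<le> r0" using that R by simp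
    have "K * s powr \<alpha> \<le> K * R powr \<alpha>" using that K \<alpha> by (intro mult_left_mono powr_mono2) auto
    then show "K * s powr \<alpha> \<le> 1/10000" using RK by linarith
  qed
  \<comment> \<open>The comparison of normals at the scale \<open>h\<close> uses circles of radius up to \<open>8 * h\<close>.\<close>
  define \<rho> where "\<rho> = R / 8"
  have \<rho>: "0 < \<rho>" "8 * \<rho> = R" using R by (auto simp: \<rho>_def)
  define A where "A = 30000 * K * 8 powr \<alpha>"
  have A: "0 < A" using K by (simp add: A_def)
  have stable: "norm (n y s - n y h) \<le> A * h powr \<alpha>"
    if "y \<in> frontier \<Omega>" "0 < h" "h \<le> s" "s \<le> 2 * h" "s \<le> \<rho>" for y h s
  proof -
    have "uniformly_split \<Omega> n (K * (8 * h) powr \<alpha>) (8 * h)" using that \<rho> by (intro loc) auto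
    then have "norm (n y s - n y h) \<le> 30000 * (K * (8 * h) powr \<alpha>)"
      by (rule uniformly_split.normal_stable) (use that in auto)
    then show ?thesis using that by (simp add: A_def powr_mult)
  qed
  define B where "B = A / (1 - 2 powr - \<alpha>)"
  have q: "(2::real) powr - \<alpha> < 1" using \<alpha> by (simp add: powr_less_one)
  then have B: "0 < B" using A by (simp add: B_def)
  have tele: "norm (n y t - n y s) \<le> B * s powr \<alpha>"
    if "y \<in> frontier \<Omega>" "0 < t" "t \<le> s" "s \<le> \<rho>" for y t s
    unfolding B_def by (rule geometric_telescope[OF \<alpha> _ stable[OF that(1)] that(2-4)]) (use A in auto)
  have "\<exists>L. norm L = 1 \<and> (\<forall>s. 0 < s \<and> s \<le> \<rho> \<longrightarrow> norm (n y s - L) \<le> B * s powr \<alpha>)"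
    if y: "y \<in> frontier \<Omega>" for y
  proof -
    have "\<exists>L. (\<forall>s. 0 < s \<and> s \<le> \<rho> \<longrightarrow> norm (n y s - L) \<le> B * s powr \<alpha>) \<and>
        (\<lambda>k. n y (\<rho> / real (Suc k))) \<longlonglongrightarrow> L"
      by (rule limit_at_zero_with_rate[OF \<alpha> \<rho>(1) less_imp_le[OF B]]) (rule tele[OF y])
    then obtain L where L: "\<forall>s. 0 < s \<and> s \<le> \<rho> \<longrightarrow> norm (n y s - L) \<le> B * s powr \<alpha>"
      "(\<lambda>k. n y (\<rho> / real (Suc k))) \<longlonglongrightarrow> L"
      by blast
    have "norm (n y (\<rho> / real (Suc k))) = 1" for k
    proof -
      have "\<rho> / real (Suc k) \<le> \<rho>" using \<rho> by (simp add: field_simps)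
      then have "\<rho> / real (Suc k) \<le> r0" "0 < \<rho> / real (Suc k)" using \<rho> R by auto
      with n[OF y] show ?thesis using splits_circle_norm by blast
    qed
    then have "norm L = 1" using tendsto_norm[OF L(2)] LIMSEQ_unique by (simp add: LIMSEQ_const_iff)
    with L(1) show ?thesis by blast
  qed
  then obtain N where N: "\<And>y. y \<in> frontier \<Omega> \<Longrightarrow> norm (N y) = 1"
    "\<And>y s. y \<in> frontier \<Omega> \<Longrightarrow> 0 < s \<Longrightarrow> s \<le> \<rho> \<Longrightarrow> norm (n y s - N y) \<le> B * s powr \<alpha>"
    by metis
  have "holder_normal \<Omega> \<alpha> (2 * B + 3 * K) \<rho> N"
    unfolding holder_normal_def
  proof (intro conjI ballI allI impI)
    fix x r assume x: "x \<in> frontier \<Omega>" and r: "0 < r \<and> r \<le> \<rho>"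
    have "K * r powr \<alpha> + B * r powr \<alpha> \<le> (2 * B + 3 * K) * r powr \<alpha>"
      using K B by (simp add: algebra_simps)
    then show "splits_circle \<Omega> x r ((2 * B + 3 * K) * r powr \<alpha>) (N x)"
      by (rule splits_circle_perturb[OF n[OF x] N(1)[OF x] N(2)[OF x], rotated 4])
        (use r R \<rho> in auto)
  next
    fix x y assume x: "x \<in> frontier \<Omega>" and y: "y \<in> frontier \<Omega>" and xy: "norm (y - x) \<le> \<rho>"
    show "norm (N x - N y) \<le> (2 * B + 3 * K) * norm (y - x) powr \<alpha>"
    proof (cases "x = y")
      case False
      define r where "r = norm (y - x)"
      have r: "0 < r" "r \<le> \<rho>" using False xy by (auto simp: r_def)
      have "uniformly_split \<Omega> n (K * r powr \<alpha>) r" using r \<rho> by (intro loc) auto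
      then have "norm (n x r - n y r) \<le> 3 * (K * r powr \<alpha>)"
        by (rule uniformly_split.nearby_normals) (use x y r in \<open>auto simp: r_def\<close>)
      moreover have "N x - N y = (n x r - n y r) - (n x r - N x) + (n y r - N y)" by simp
      then have "norm (N x - N y) \<le> norm (n x r - n y r) + norm (n x r - N x) + norm (n y r - N y)"
        by (metis norm_triangle_ineq norm_triangle_ineq4 add_right_mono order_trans)
      ultimately show ?thesis
        using N(2)[OF x r] N(2)[OF y r] by (simp add: r_def algebra_simps)
    qed simp
  qed
  moreover have "0 < 2 * B + 3 * K" using B K by simp
  ultimately show ?thesis using \<rho>(1) by blast
qed

section \<open>The boundary as a graph\<close>

lemma tendsto_abs_diff_powr_zero:
  fixes t \<alpha> C :: real
  assumes "0 < \<alpha>"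
  shows "((\<lambda>s. C * \<bar>s - t\<bar> powr \<alpha>) \<longlongrightarrow> 0) (at t within S)"
proof -
  have "((\<lambda>s. s - t) \<longlongrightarrow> t - t) (at t within S)" by (intro tendsto_intros)
  then have "((\<lambda>s. \<bar>s - t\<bar>) \<longlongrightarrow> 0) (at t within S)" by (auto intro: tendsto_rabs_zero)
  then have "((\<lambda>s. \<bar>s - t\<bar> powr \<alpha>) \<longlongrightarrow> 0) (at t within S)"
    using assms by (intro tendsto_zero_powrI[where b = \<alpha>]) auto
  then show ?thesis using tendsto_mult_right_zero by blast
qed

text \<open>If the affine approximation has an error of order \<open>1 + \<alpha>\<close> uniformly in both points, exchanging the
  two points and adding shows that the slopes are Hoelder continuous.\<close>

lemma C1_holder_on_of_tangents:
  fixes f D :: "real \<Rightarrow> real"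
  assumes \<alpha>: "0 < \<alpha>"
    and est: "\<And>s t. s \<in> {a<..<b} \<Longrightarrow> t \<in> {a<..<b} \<Longrightarrow>
      \<bar>f t - f s - D s * (t - s)\<bar> \<le> C * \<bar>t - s\<bar> powr \<alpha> * \<bar>t - s\<bar>"
  shows "C1_holder_on \<alpha> {a<..<b} f"
proof -
  let ?J = "{a<..<b}"
  have der: "(f has_field_derivative D s) (at s)" if s: "s \<in> ?J" for s
  proof -
    have "eventually (\<lambda>t. t \<in> ?J) (at s)" using s by (intro eventually_at_in_open') auto
    moreover have "eventually (\<lambda>t. t \<noteq> s) (at s)" by (rule eventually_neq_at_within)
    ultimately have "eventually (\<lambda>t. norm ((f t - f s) / (t - s) - D s) \<le> C * \<bar>t - s\<bar> powr \<alpha>) (at s)"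
    proof eventually_elim
      case (elim t)
      then have "(f t - f s) / (t - s) - D s = (f t - f s - D s * (t - s)) / (t - s)"
        by (simp add: field_simps)
      then have "norm ((f t - f s) / (t - s) - D s) = \<bar>f t - f s - D s * (t - s)\<bar> / \<bar>t - s\<bar>"
        by simp
      also have "\<dots> \<le> C * \<bar>t - s\<bar> powr \<alpha>"
        using est[OF s elim(1)] elim by (simp add: pos_divide_le_eq)
      finally show ?case .
    qed
    from Lim_null_comparison[OF this tendsto_abs_diff_powr_zero[OF \<alpha>]]
    show ?thesis unfolding has_field_derivative_iff by (rule LIM_zero_cancel)
  qed
  have d: "deriv f s = D s" if "s \<in> ?J" for s using DERIV_imp_deriv[OF der[OF that]] .
  have hol: "\<bar>deriv f s - deriv f t\<bar> \<le> (2 * C) * \<bar>s - t\<bar> powr \<alpha>" if "s \<in> ?J" "t \<in> ?J" for s t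
  proof (cases "s = t")
    case False
    have "(D s - D t) * (t - s) = - (f t - f s - D s * (t - s)) - (f s - f t - D t * (s - t))"
      by (simp add: algebra_simps)
    then have "\<bar>D s - D t\<bar> * \<bar>t - s\<bar> \<le> \<bar>f t - f s - D s * (t - s)\<bar> + \<bar>f s - f t - D t * (s - t)\<bar>"
      unfolding abs_mult[symmetric] by linarith
    also have "\<dots> \<le> (2 * C) * \<bar>s - t\<bar> powr \<alpha> * \<bar>t - s\<bar>"
      using est[OF that] est[OF that(2,1)] by (simp add: abs_minus_commute)
    finally show ?thesis using False d that by simp
  qed simp
  have "continuous_on ?J (deriv f)"
    unfolding continuous_on_def
  proof
    fix s assume s: "s \<in> ?J"
    have "eventually (\<lambda>t. norm (deriv f t - deriv f s) \<le> (2 * C) * \<bar>t - s\<bar> powr \<alpha>) (at s within ?J)"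
      using hol[OF _ s] by (simp add: eventually_at_filter)
    from Lim_null_comparison[OF this tendsto_abs_diff_powr_zero[OF \<alpha>]]
    show "(deriv f \<longlongrightarrow> deriv f s) (at s within ?J)" by (rule LIM_zero_cancel)
  qed
  moreover have "f differentiable_on ?J"
    unfolding differentiable_on_def
    using der by (meson differentiableI differentiable_at_withinI has_field_derivative_imp_has_derivative)
  ultimately show ?thesis using hol unfolding C1_holder_on_def by blast
qed

text \<open>Near \<open>p\<close>, all normals are within \<open>1/10\<close> of the normal \<open>M\<close> at \<open>p\<close>. The cone condition that follows makes the
  projection to the tangent line \<open>T\<close> injective on the boundary. It is onto an interval because the points
  straight above and below the tangent line lie on different sides of the boundary.\<close>

lemma holder_normal_curve:
  assumes op: "open \<Omega>" and pos: "0 < \<alpha>" "0 < B" "0 < \<rho>" and hn: "holder_normal \<Omega> \<alpha> B \<rho> \<nu>"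
  shows "C1_holder_curve \<alpha> (frontier \<Omega>)"
  unfolding C1_holder_curve_def
proof
  fix p assume p: "p \<in> frontier \<Omega>"
  let ?\<Gamma> = "frontier \<Omega>"
  have split: "splits_circle \<Omega> x r (B * r powr \<alpha>) (\<nu> x)" if "x \<in> ?\<Gamma>" "0 < r" "r \<le> \<rho>" for x r
    using hn that by (simp add: holder_normal_def)
  have hol: "norm (\<nu> x - \<nu> y) \<le> B * norm (y - x) powr \<alpha>" if "x \<in> ?\<Gamma>" "y \<in> ?\<Gamma>" "norm (y - x) \<le> \<rho>" for x y
    using hn that by (simp add: holder_normal_def)
  define \<delta> where "\<delta> = min \<rho> ((1 / (10 * B)) powr (1 / \<alpha>))"
  have \<delta>: "0 < \<delta>" "\<delta> \<le> \<rho>" using pos by (auto simp: \<delta>_def)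
  have small: "B * r powr \<alpha> \<le> 1/10" if "0 \<le> r" "r \<le> \<delta>" for r
  proof -
    have "r powr \<alpha> \<le> ((1 / (10 * B)) powr (1 / \<alpha>)) powr \<alpha>"
      using that pos by (intro powr_mono2) (auto simp: \<delta>_def)
    also have "\<dots> = 1 / (10 * B)" using pos by (simp add: powr_powr)
    finally show ?thesis using pos by (simp add: field_simps)
  qed
  define a where "a = \<delta> / 4"
  have a: "0 < a" "\<delta> = 4 * a" using \<delta> by (auto simp: a_def)
  define M where "M = \<nu> p"
  have M: "norm M = 1" using splits_circle_norm[OF split[OF p \<delta>]] by (simp add: M_def)
  define T where "T = - (\<i> * M)"
  have T: "norm T = 1" using M by (simp add: T_def norm_mult)
  have MT: "M = \<i> * T" by (simp add: T_def)
  have ii: "M \<bullet> M = 1" "T \<bullet> T = 1" "T \<bullet> M = 0" "M \<bullet> T = 0"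
    using M T by (simp_all add: norm_eq_1 T_def)
  have frame: "(w \<bullet> T)\<^sup>2 + (w \<bullet> M)\<^sup>2 = (norm w)\<^sup>2" for w using frame_norm[OF T, of w] by (simp add: MT)
  have expand: "w = (w \<bullet> T) *\<^sub>R T + (w \<bullet> M) *\<^sub>R M" for w
  proof -
    have "norm (w - ((w \<bullet> T) *\<^sub>R T + (w \<bullet> M) *\<^sub>R M)) ^ 2 = 0"
      unfolding frame[symmetric] by (simp add: inner_diff_left inner_add_left ii)
    then show ?thesis by simp
  qed
  have cone: "norm (y - x) \<le> 2 * \<bar>(y - x) \<bullet> T\<bar>"
    "\<bar>(y - x) \<bullet> \<nu> x\<bar> \<le> B * norm (y - x) powr \<alpha> * norm (y - x)"
    "9/10 \<le> M \<bullet> \<nu> x"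
    if "x \<in> ?\<Gamma>" "y \<in> ?\<Gamma>" "norm (x - p) \<le> \<delta>" "norm (y - x) \<le> \<delta>" for x y
  proof -
    have \<nu>M: "norm (\<nu> x - M) \<le> 1/10"
      using hol[OF that(1) p] small[of "norm (x - p)"] that(3) \<delta>
      by (simp add: M_def norm_minus_commute)
    have "\<bar>M \<bullet> (\<nu> x - M)\<bar> \<le> 1/10" using Cauchy_Schwarz_ineq2[of M "\<nu> x - M"] M \<nu>M by simp
    moreover have "M \<bullet> (\<nu> x - M) = M \<bullet> \<nu> x - 1" by (simp add: inner_diff_right ii)
    ultimately show "9/10 \<le> M \<bullet> \<nu> x" by linarith
    show *: "\<bar>(y - x) \<bullet> \<nu> x\<bar> \<le> B * norm (y - x) powr \<alpha> * norm (y - x)"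
    proof (cases "x = y")
      case False
      then have r: "0 < norm (y - x)" "norm (y - x) \<le> \<rho>" using that \<delta> by auto
      show ?thesis by (rule splits_circle_near[OF op split[OF that(1) r] that(2) refl r(1)])
    qed simp
    have "B * norm (y - x) powr \<alpha> * norm (y - x) \<le> 1/10 * norm (y - x)"
      using small[of "norm (y - x)"] that(4) by (intro mult_right_mono) auto
    moreover have "\<bar>(y - x) \<bullet> (\<nu> x - M)\<bar> \<le> norm (y - x) * (1/10)"
      using Cauchy_Schwarz_ineq2[of "y - x" "\<nu> x - M"] mult_left_mono[OF \<nu>M, of "norm (y - x)"]
      by simp
    moreover have "(y - x) \<bullet> M = (y - x) \<bullet> \<nu> x - (y - x) \<bullet> (\<nu> x - M)" by (simp add: inner_diff_right)
    ultimately have "\<bar>(y - x) \<bullet> M\<bar> \<le> 1/5 * norm (y - x)" using * by linarith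
    then have "\<bar>(y - x) \<bullet> M\<bar>\<^sup>2 \<le> (1/5 * norm (y - x))\<^sup>2" by (rule power_mono) simp
    then have "25 * ((y - x) \<bullet> M)\<^sup>2 \<le> (norm (y - x))\<^sup>2" by (simp add: power_divide)
    then have "(norm (y - x))\<^sup>2 \<le> 4 * ((y - x) \<bullet> T)\<^sup>2"
      using frame[of "y - x"] zero_le_power2[of "(y - x) \<bullet> T"] by linarith
    then have "(norm (y - x))\<^sup>2 \<le> (2 * \<bar>(y - x) \<bullet> T\<bar>)\<^sup>2"
      by (simp add: power_mult_distrib)
    then show "norm (y - x) \<le> 2 * \<bar>(y - x) \<bullet> T\<bar>" by (rule power2_le_imp_le) simp
  qed
  define U where "U = {z. \<bar>(z - p) \<bullet> T\<bar> < a \<and> \<bar>(z - p) \<bullet> M\<bar> < a}"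
  have "open U" unfolding U_def
    by (intro open_Collect_conj open_Collect_less continuous_intros)
  have "p \<in> U" using a by (simp add: U_def)
  have Ur: "norm (z - p) \<le> 2 * a" if "z \<in> U" for z
  proof (rule power2_le_imp_le)
    have "\<bar>(z - p) \<bullet> T\<bar>\<^sup>2 \<le> a\<^sup>2" "\<bar>(z - p) \<bullet> M\<bar>\<^sup>2 \<le> a\<^sup>2"
      using that by (intro power_mono; simp add: U_def)+
    then have "(norm (z - p))\<^sup>2 \<le> 4 * a\<^sup>2"
      using frame[of "z - p"] zero_le_power2[of a] unfolding power2_abs by linarith
    then show "(norm (z - p))\<^sup>2 \<le> (2 * a)\<^sup>2" by (simp add: power_mult_distrib)
  qed (use a in simp)
  have Uxy: "norm (x - p) \<le> \<delta>" "norm (y - x) \<le> \<delta>" if "x \<in> U" "y \<in> U" for x y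
    using Ur[OF that(1)] Ur[OF that(2)] norm_triangle_ineq4[of "y - p" "x - p"] a by auto
  define t0 where "t0 = p \<bullet> T"
  let ?J = "{t0 - a<..<t0 + a}"
  have "\<exists>x. x \<in> ?\<Gamma> \<inter> U \<and> x \<bullet> T = t" if t: "t \<in> ?J" for t
  proof -
    define s where "s = t - t0"
    have s: "\<bar>s\<bar> < a" using t by (auto simp: s_def)
    have pt: "norm (s *\<^sub>R T + c *\<^sub>R M) > 0 \<and> norm (s *\<^sub>R T + c *\<^sub>R M) \<le> 2 * a" if "\<bar>c\<bar> = a / 2" for c
    proof -
      have sq: "(norm (s *\<^sub>R T + c *\<^sub>R M))\<^sup>2 = s\<^sup>2 + c\<^sup>2"
        unfolding frame[symmetric] by (simp add: inner_add_left ii)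
      have "c \<noteq> 0" using that a by auto
      then have "0 < s\<^sup>2 + c\<^sup>2" by (simp add: add_nonneg_pos)
      moreover have "s\<^sup>2 + c\<^sup>2 \<le> (2 * a)\<^sup>2"
      proof -
        have "\<bar>s\<bar>\<^sup>2 \<le> a\<^sup>2" "\<bar>c\<bar>\<^sup>2 \<le> a\<^sup>2" using s that a by (intro power_mono; simp)+
        then have "s\<^sup>2 + c\<^sup>2 \<le> 4 * a\<^sup>2" using zero_le_power2[of a] unfolding power2_abs by linarith
        then show ?thesis by (simp add: power_mult_distrib)
      qed
      ultimately show ?thesis using a sq power2_le_imp_le[of "norm (s *\<^sub>R T + c *\<^sub>R M)" "2 * a"] by auto
    qed
    have unit: "norm ((1 / r) *\<^sub>R w) = 1 \<and> r *\<^sub>R ((1 / r) *\<^sub>R w) = w" if "r = norm w" "0 < r" for r and w :: complex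
      using that by auto
    have up: "p + (s *\<^sub>R T + (a / 2) *\<^sub>R M) \<in> \<Omega>"
    proof -
      define w r where "w = s *\<^sub>R T + (a / 2) *\<^sub>R M" and "r = norm w"
      have r: "0 < r" "r \<le> 2 * a" "r \<le> \<rho>" using pt[of "a / 2"] a \<delta> by (auto simp: w_def r_def)
      have "1/4 \<le> ((1 / r) *\<^sub>R w) \<bullet> M"
        using r a by (simp add: w_def inner_add_left ii field_simps)
      moreover have "B * r powr \<alpha> \<le> 1/10" using r a by (intro small) auto
      ultimately have "B * r powr \<alpha> < ((1 / r) *\<^sub>R w) \<bullet> M" by linarith
      from splits_circle_in[OF split[OF p r(1,3)] conjunct1[OF unit[OF r_def r(1)]]] this
      show ?thesis using r by (simp add: M_def w_def)
    qed
    have down: "p + (s *\<^sub>R T + (- (a / 2)) *\<^sub>R M) \<notin> \<Omega>"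
    proof -
      define w r where "w = s *\<^sub>R T + (- (a / 2)) *\<^sub>R M" and "r = norm w"
      have r: "0 < r" "r \<le> 2 * a" "r \<le> \<rho>" using pt[of "- (a / 2)"] a \<delta> by (auto simp: w_def r_def)
      have "((1 / r) *\<^sub>R w) \<bullet> M \<le> - (1/4)"
        using r a by (simp add: w_def inner_diff_left ii field_simps)
      moreover have "B * r powr \<alpha> \<le> 1/10" using r a by (intro small) auto
      ultimately have "((1 / r) *\<^sub>R w) \<bullet> M < - (B * r powr \<alpha>)" by linarith
      from splits_circle_out[OF split[OF p r(1,3)] conjunct1[OF unit[OF r_def r(1)]]] this
      have "p + w \<notin> closure \<Omega>" using r by (simp add: M_def)
      then show ?thesis using closure_subset by (auto simp: w_def)
    qed
    let ?A = "(\<lambda>c. p + (s *\<^sub>R T + c *\<^sub>R M)) ` {- (a / 2)..a / 2}"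
    have "connected ?A" by (intro connected_continuous_image continuous_intros) auto
    moreover have "a / 2 \<in> {- (a / 2)..a / 2}" "- (a / 2) \<in> {- (a / 2)..a / 2}" using a by auto
    ultimately have "?A \<inter> ?\<Gamma> \<noteq> {}" using up down by (intro connected_Int_frontier) blast+
    then obtain c where c: "- (a / 2) \<le> c" "c \<le> a / 2" "p + (s *\<^sub>R T + c *\<^sub>R M) \<in> ?\<Gamma>" by auto
    moreover have "p + (s *\<^sub>R T + c *\<^sub>R M) \<in> U"
      using c s a by (auto simp: U_def inner_add_left ii)
    moreover have "(p + (s *\<^sub>R T + c *\<^sub>R M)) \<bullet> T = t" by (simp add: inner_add_left ii s_def t0_def)
    ultimately show ?thesis by blast
  qed
  then obtain X where X: "\<And>t. t \<in> ?J \<Longrightarrow> X t \<in> ?\<Gamma>" "\<And>t. t \<in> ?J \<Longrightarrow> X t \<in> U" "\<And>t. t \<in> ?J \<Longrightarrow> X t \<bullet> T = t"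
    by (metis IntE)
  define f where "f t = X t \<bullet> M" for t
  have graph: "cis (Arg T) * Complex t (f t) = X t" if "t \<in> ?J" for t
  proof -
    have "T \<noteq> 0" using T by auto
    then have "cis (Arg T) = T" using T cis_Arg[of T] by (simp add: sgn_div_norm)
    moreover have "T * Complex t y = t *\<^sub>R T + y *\<^sub>R M" for y
      by (simp add: MT complex_eq_iff algebra_simps)
    ultimately show ?thesis using expand[of "X t"] X(3)[OF that] by (simp add: f_def)
  qed
  have "?\<Gamma> \<inter> U = X ` ?J"
  proof
    show "X ` ?J \<subseteq> ?\<Gamma> \<inter> U" using X by blast
    show "?\<Gamma> \<inter> U \<subseteq> X ` ?J"
    proof
      fix z assume z: "z \<in> ?\<Gamma> \<inter> U"
      then have J: "z \<bullet> T \<in> ?J" by (auto simp: U_def t0_def inner_diff_left)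
      have "norm (z - X (z \<bullet> T)) \<le> 2 * \<bar>(z - X (z \<bullet> T)) \<bullet> T\<bar>"
        using z X[OF J] Uxy by (intro cone) auto
      then have "z = X (z \<bullet> T)" using X(3)[OF J] by (simp add: inner_diff_left)
      with J show "z \<in> X ` ?J" by blast
    qed
  qed
  also have "\<dots> = (\<lambda>t. cis (Arg T) * Complex t (f t)) ` ?J" using graph by (intro image_cong) auto
  finally have img: "?\<Gamma> \<inter> U = (\<lambda>t. cis (Arg T) * Complex t (f t)) ` ?J" .
  have "C1_holder_on \<alpha> ?J f"
  proof (rule C1_holder_on_of_tangents[OF pos(1)])
    fix s t assume s: "s \<in> ?J" and t: "t \<in> ?J"
    define w m where "w = X t - X s" and "m = M \<bullet> \<nu> (X s)"
    note c = cone[OF X(1)[OF s] X(1)[OF t] Uxy[OF X(2)[OF s] X(2)[OF t]], folded w_def m_def]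
    have wT: "w \<bullet> T = t - s" "w \<bullet> M = f t - f s"
      using X(3)[OF s] X(3)[OF t] by (simp_all add: w_def f_def inner_diff_left)
    have w: "norm w \<le> 2 * \<bar>t - s\<bar>" using c(1) wT by simp
    have m: "9/10 \<le> m" using c(3) .
    have "w \<bullet> \<nu> (X s) = (t - s) * (T \<bullet> \<nu> (X s)) + (f t - f s) * m"
      by (subst expand[of w]) (simp add: wT inner_add_left m_def)
    then have eq: "f t - f s - (- (T \<bullet> \<nu> (X s)) / m) * (t - s) = (w \<bullet> \<nu> (X s)) / m"
      using m by (simp add: field_simps)
    have "\<bar>w \<bullet> \<nu> (X s)\<bar> \<le> B * (2 * \<bar>t - s\<bar>) powr \<alpha> * (2 * \<bar>t - s\<bar>)"
      by (rule order_trans[OF c(2)]) (use w pos in \<open>intro mult_mono powr_mono2; simp\<close>)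
    then have "\<bar>w \<bullet> \<nu> (X s)\<bar> / m \<le> (B * (2 * \<bar>t - s\<bar>) powr \<alpha> * (2 * \<bar>t - s\<bar>)) / (1/2)"
      using m pos by (intro frac_le) auto
    also have "\<dots> = (4 * B * 2 powr \<alpha>) * \<bar>t - s\<bar> powr \<alpha> * \<bar>t - s\<bar>" by (simp add: powr_mult)
    finally show "\<bar>f t - f s - (- (T \<bullet> \<nu> (X s)) / m) * (t - s)\<bar>
        \<le> (4 * B * 2 powr \<alpha>) * \<bar>t - s\<bar> powr \<alpha> * \<bar>t - s\<bar>"
      unfolding eq using m by simp
  qed
  with \<open>open U\<close> \<open>p \<in> U\<close> img
  show "\<exists>U \<theta> a b f. open U \<and> p \<in> U \<and> C1_holder_on \<alpha> {a<..<b} f \<and>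
      ?\<Gamma> \<inter> U = (\<lambda>t. cis \<theta> * Complex t (f t)) ` {a<..<b}" by blast
qed

theorem theorem1:
  fixes \<alpha> :: real
  assumes "0 < \<alpha>" and "\<alpha> < 1"
  shows "\<exists>\<beta>>0. \<forall>(\<Omega> :: complex set) C0.
           jordan_domain \<Omega> \<longrightarrow> C0 > 0 \<longrightarrow>
           (\<exists>r0>0. \<forall>x\<in>frontier \<Omega>. \<forall>r. 0 < r \<and> r \<le> r0 \<longrightarrow>
              carleson_eps \<Omega> x r \<le> C0 * r powr \<alpha>) \<longrightarrow>
           C1_holder_curve \<beta> (frontier \<Omega>)"
proof (intro exI[of _ \<alpha>] conjI allI impI)
  fix \<Omega> :: "complex set" and C0 :: real
  assume "jordan_domain \<Omega>" and C0: "C0 > 0"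
    and "\<exists>r0>0. \<forall>x\<in>frontier \<Omega>. \<forall>r. 0 < r \<and> r \<le> r0 \<longrightarrow> carleson_eps \<Omega> x r \<le> C0 * r powr \<alpha>"
  then obtain r0 where op: "open \<Omega>" and r0: "r0 > 0"
    and eps: "\<And>x r. x \<in> frontier \<Omega> \<Longrightarrow> 0 < r \<Longrightarrow> r \<le> r0 \<Longrightarrow> carleson_eps \<Omega> x r \<le> C0 * r powr \<alpha>"
    by (auto simp: jordan_domain_def)
  \<comment> \<open>Below \<open>r1\<close> the defect is at most \<open>1 < pi\<close>, so that the largest arcs are not empty.\<close>
  define r1 where "r1 = min r0 ((1 / C0) powr (1 / \<alpha>))"
  have r1: "0 < r1" "r1 \<le> r0" using r0 C0 by (auto simp: r1_def)
  have split: "\<exists>n. splits_circle \<Omega> x r ((2 * C0) * r powr \<alpha>) n"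
    if x: "x \<in> frontier \<Omega>" and r: "0 < r" "r \<le> r1" for x r
  proof -
    have "r powr \<alpha> \<le> ((1 / C0) powr (1 / \<alpha>)) powr \<alpha>"
      using r assms by (intro powr_mono2) (auto simp: r1_def)
    also have "\<dots> = 1 / C0" using assms C0 by (simp add: powr_powr)
    finally have "C0 * r powr \<alpha> < pi" using C0 pi_gt3 by (simp add: field_simps)
    with carleson_eps_split_circle[OF r(1) eps[OF x r(1)]] r r1 show ?thesis by (simp add: mult.assoc)
  qed
  have "0 < 2 * C0" using C0 by simp
  then have "\<exists>B \<rho> N. 0 < B \<and> 0 < \<rho> \<and> holder_normal \<Omega> \<alpha> B \<rho> N"
    by (rule holder_normal_exists[OF op assms(1) _ r1(1)]) (rule split)
  then obtain B \<rho> N where "0 < B" "0 < \<rho>" "holder_normal \<Omega> \<alpha> B \<rho> N" by blast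
  with holder_normal_curve[OF op assms(1)] show "C1_holder_curve \<alpha> (frontier \<Omega>)" by blast
qed (rule assms(1))

end
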